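(* Under the standing assumptions for the block model given in the context, for any $\beta\in[0,\infty)$, as $n\to\infty$, $$\log Z(\beta)-\sum_{1\le s\le t\le\ell} m_{s,t}\,\psi_{s,t}(\beta)\Rightarrow \mathrm N\left(-\sum_{1\le s\le t\le\ell}\gamma_{s,t}\,v_\beta^2(s,t),\ 2\sum_{1\le s\le t\le\ell}\gamma_{s,t}\,v_\beta^2(s,t)\right),$$ where $v_\beta^2(s,t)=\exp\left(\psi_{s,t}(2\beta)-2\psi_{s,t}(\beta)\right)-1$ and $\Rightarrow$ denotes convergence in distribution.
   Context: Graph: for fixed $\ell\ge2$, the vertex set has size $n$ and is partitioned into $\ell$ blocks of sizes $n_1,\dots,n_\ell$ with $n_i/n\to\lambda_i>0$ and $\lambda_1+\cdots+\lambda_\ell=1$. For $1\le s\le t\le\ell$, $E_{s,t}$ is the set of edges between block $s$ and block $t$, with $|E_{s,t}|=n_sn_t$ for $s<t$ and $|E_{s,s}|=n_s(n_s-1)/2$ (all pairs of distinct vertices are joined); $E=\bigcup_{s\le t}E_{s,t}$. Weights: $\{\omega_e\}_{e\in E}$ are independent; for $e\in E_{s,t}$ the law of $\omega_e$ depends only on $(s,t)$ (and not on $n$); with $\omega_{st}$ denoting a random variable with this law, $\psi_{s,t}(\beta):=\log\mathbb E e^{-\beta\omega_{st}}<\infty$ for all $\beta\in[0,\infty)$. Weights may equal $+\infty$ with positive probability (but not almost surely), with the convention $e^{-\beta\cdot(+\infty)}=0$ for every $\beta\ge0$. Optimization problem: $\mathcal S=\mathcal S(n)$ is a nonempty collection of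 spanning subgraphs, identified with their edge sets; $\widetilde{\mathcal S}$ is the collection of all subsets of elements of $\mathcal S$. A partial matching is a set of pairwise vertex-disjoint edges. $\mathbb P_0$ is the law of $\pi$ uniform on $\mathcal S$. It is assumed that: (1') for every $\pi\in\mathcal S$ and $1\le s\le t\le\ell$, $|\pi\cap E_{s,t}|=m_{s,t}$ with $m_{s,t}=m_{s,t}(n)$ not depending on $\pi$, and $\lim_{n\to\infty}\frac{m_{s,t}^2}{2|E_{s,t}|}=\gamma_{s,t}\in(0,\infty)$; write $m=\sum_{s\le t}m_{s,t}$; (2) for every partial matching $\Gamma\subseteq E$ there is $\pi\in\mathcal S$ with $\Gamma\subseteq\pi$; (3) there is a constant $\rho\in(0,\infty)$ (independent of $n$) such that for every $k\in\mathbb N$ and every partial matching $\Gamma$ with $k$ edges, $\left|\frac{\mathbb P_0(\Gamma\subseteq\pi)}{\prod_{e\in\Gamma}\mathbb P_0(e\in\pi)}-1\right|\le\frac{\rho^k}{\sqrt m}$; (4) there is a constant $\rho\in(0,\infty)$ (independent of $n$) such that for every $k\in\mathbb N$ and every $\Gamma\in\widetilde{\mathcal S}$ with $k$ edges that is not a partial matching, $\mathbb P_0(\Gamma\subseteq\pi)\le\rho^k\prod_{e\in\Gamma}\mathbb P_0(e\in\pi)$. Moreover $\mathbb P_0(e\in\pi)=p_{s,t}:=m_{s,t}/|E_{s,t}|$ for every $e\in E_{s,t}$, $s\le t$. Partition function: $Z(\beta)=\frac1{|\mathcal S|}\sum_{\pi\in\mathcal S}\exp\left(-\beta\sum_{e\in\pi}\omega_e\right)$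 (with $\log0=-\infty$). $\mathrm N(\mu,\sigma^2)$ is the normal law with mean $\mu$ and variance $\sigma^2$. *)

theory Defs
  imports "HOL-Probability.Probability"
begin

text \<open>An edge is an unordered pair of distinct vertices, represented as a two-element set.\<close>

definition edges_between :: "'v set \<Rightarrow> 'v set \<Rightarrow> 'v set set" where
  "edges_between A B = {{u, v} |u v. u \<in> A \<and> v \<in> B \<and> u \<noteq> v}"

lemma card_edges_between_disjoint:
  assumes "finite A" "finite B" "A \<inter> B = {}"
  shows "card (edges_between A B) = card A * card B"
proof -
  have "bij_betw (\<lambda>(u, v). {u, v}) (A \<times> B) (edges_between A B)"
    using assms(3) by (fastforce simp: bij_betw_def inj_on_def edges_between_def doubleton_eq_iff)
  then have "card (A \<times> B) = card (edges_between A B)"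
    by (rule bij_betw_same_card)
  then show ?thesis
    by (simp add: card_cartesian_product)
qed

lemma card_edges_between_same:
  assumes "finite A"
  shows "card (edges_between A A) = card A * (card A - 1) div 2"
proof -
  have "edges_between A A = {K. K \<subseteq> A \<and> card K = 2}"
    by (auto simp: edges_between_def card_2_iff)
  then show ?thesis
    using n_subsets[OF assms, of 2] by (simp add: choose_two)
qed

definition partial_matching :: "'v set set \<Rightarrow> bool" where
  "partial_matching \<Gamma> \<longleftrightarrow> (\<forall>e\<in>\<Gamma>. \<forall>f\<in>\<Gamma>. e \<noteq> f \<longrightarrow> e \<inter> f = {})"

definition block_pairs :: "nat \<Rightarrow> (nat \<times> nat) set" where
  "block_pairs L = {(s, t). 1 \<le> s \<and> s \<le> t \<and> t \<le> L}"

text \<open>\<^term>\<open>B n i\<close> is the \<^term>\<open>i\<close>-th block of the graph with \<^term>\<open>n\<close> vertices.\<close>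

definition block_edges :: "nat \<Rightarrow> (nat \<Rightarrow> nat \<Rightarrow> 'v set) \<Rightarrow> nat \<Rightarrow> 'v set set" where
  "block_edges L B n = (\<Union>(s, t)\<in>block_pairs L. edges_between (B n s) (B n t))"

text \<open>The factor \<open>exp (- \<beta> * x)\<close> for \<open>x \<in> (-\<infinity>, \<infinity>]\<close>, with value \<open>0\<close> at
  \<open>x = \<infinity>\<close> for every \<open>\<beta> \<ge> 0\<close>, including \<open>\<beta> = 0\<close>. Its value at \<open>x = -\<infinity>\<close> is irrelevant,
  because the weights avoid \<open>-\<infinity>\<close> almost surely.\<close>

definition boltzmann :: "real \<Rightarrow> ereal \<Rightarrow> real" where
  "boltzmann \<beta> x = (if x = \<infinity> then 0 else exp (- \<beta> * real_of_ereal x))"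

definition psi :: "ereal measure \<Rightarrow> real \<Rightarrow> real" where
  "psi \<nu> \<beta> = ln (\<integral>x. boltzmann \<beta> x \<partial>\<nu>)"

definition v2 :: "ereal measure \<Rightarrow> real \<Rightarrow> real" where
  "v2 \<nu> \<beta> = exp (psi \<nu> (2 * \<beta>) - 2 * psi \<nu> \<beta>) - 1"

definition partition_function :: "'v set set set \<Rightarrow> ('v set \<Rightarrow> ereal) \<Rightarrow> real \<Rightarrow> real" where
  "partition_function S w \<beta> = (\<Sum>\<pi>\<in>S. boltzmann \<beta> (\<Sum>e\<in>\<pi>. w e)) / real (card S)"

text \<open>The partition function may vanish, in which case its logarithm is \<open>-\<infinity>\<close>.\<close>

definition log_partition :: "'v set set set \<Rightarrow> ('v set \<Rightarrow> ereal) \<Rightarrow> real \<Rightarrow> ereal" where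
  "log_partition S w \<beta> =
     (if partition_function S w \<beta> = 0 then -\<infinity> else ereal (ln (partition_function S w \<beta>)))"

text \<open>The law \<open>N(\<mu>, v)\<close> with mean \<open>\<mu>\<close> and variance \<open>v \<ge> 0\<close>; the second argument of
  \<^const>\<open>normal_density\<close> is the standard deviation. For \<open>v = 0\<close> it is the point mass at \<open>\<mu>\<close>.\<close>

definition normal_law :: "real \<Rightarrow> real \<Rightarrow> real measure" where
  "normal_law \<mu> v =
     (if v = 0 then return borel \<mu> else density lborel (\<lambda>x. ennreal (normal_density \<mu> (sqrt v) x)))"

text \<open>Convergence in distribution of extended-real random variables, possibly defined on
  different probability spaces, to a law on the real line. As that law has no mass at
  \<open>\<plusminus>\<infinity>\<close>, pointwise convergence of the distribution functions at the continuity points of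
  the limit on the real line is convergence in distribution.\<close>

definition converges_in_distribution ::
    "(nat \<Rightarrow> 'w measure) \<Rightarrow> (nat \<Rightarrow> 'w \<Rightarrow> ereal) \<Rightarrow> real measure \<Rightarrow> bool" where
  "converges_in_distribution M X \<mu> \<longleftrightarrow>
     weak_conv (\<lambda>n x. \<P>(\<omega> in M n. X n \<omega> \<le> ereal x)) (cdf \<mu>)"

locale block_graphs =
  fixes L :: nat
    and V :: "nat \<Rightarrow> 'v set"
    and B :: "nat \<Rightarrow> nat \<Rightarrow> 'v set"
    and lam :: "nat \<Rightarrow> real"
  assumes L_ge_2: "2 \<le> L"
    and finite_V: "\<And>n. finite (V n)"
    and card_V: "\<And>n. card (V n) = n"
    and blocks_cover: "\<And>n. (\<Union>i\<in>{1..L}. B n i) = V n"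
    and blocks_disjoint: "\<And>n. disjoint_family_on (B n) {1..L}"
    and block_proportions:
      "\<And>i. i \<in> {1..L} \<Longrightarrow> (\<lambda>n. real (card (B n i)) / real n) \<longlonglongrightarrow> lam i"
    and lam_pos: "\<And>i. i \<in> {1..L} \<Longrightarrow> 0 < lam i"
    and lam_sum: "(\<Sum>i\<in>{1..L}. lam i) = 1"

text \<open>\<^term>\<open>\<nu> s t\<close> is the law of the weights of the edges between blocks \<^term>\<open>s\<close> and
  \<^term>\<open>t\<close>; the probability space \<^term>\<open>M n\<close> carrying the weights may depend on \<^term>\<open>n\<close>.\<close>

locale block_weights = block_graphs L V B lam
  for L :: nat and V :: "nat \<Rightarrow> 'v set" and B lam +
  fixes \<nu> :: "nat \<Rightarrow> nat \<Rightarrow> ereal measure"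
    and M :: "nat \<Rightarrow> 'w measure"
    and \<omega> :: "nat \<Rightarrow> 'v set \<Rightarrow> 'w \<Rightarrow> ereal"
  assumes prob_space_M: "\<And>n. prob_space (M n)"
    and weights_indep:
      "\<And>n. prob_space.indep_vars (M n) (\<lambda>_. borel) (\<omega> n) (block_edges L B n)"
    and weights_law:
      "\<And>n s t e. (s, t) \<in> block_pairs L \<Longrightarrow> e \<in> edges_between (B n s) (B n t) \<Longrightarrow>
         distr (M n) borel (\<omega> n e) = \<nu> s t"
    and prob_space_law: "\<And>s t. (s, t) \<in> block_pairs L \<Longrightarrow> prob_space (\<nu> s t)"
    and sets_law: "\<And>s t. (s, t) \<in> block_pairs L \<Longrightarrow> sets (\<nu> s t) = sets borel"
    and law_not_minus_infinity: "\<And>s t. (s, t) \<in> block_pairs L \<Longrightarrow> AE x in \<nu> s t. x \<noteq> -\<infinity>"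
    and law_not_infinity: "\<And>s t. (s, t) \<in> block_pairs L \<Longrightarrow> \<not> (AE x in \<nu> s t. x = \<infinity>)"
    and law_exp_integrable:
      "\<And>s t \<beta>. (s, t) \<in> block_pairs L \<Longrightarrow> 0 \<le> \<beta> \<Longrightarrow> integrable (\<nu> s t) (boltzmann \<beta>)"

text \<open>A spanning subgraph is identified with its set of edges. The uniform law on
  \<^term>\<open>S n\<close> is \<^term>\<open>pmf_of_set (S n)\<close>.\<close>

locale block_optimization = block_weights L V B lam \<nu> M \<omega>
  for L :: nat and V :: "nat \<Rightarrow> 'v set" and B lam \<nu> and M :: "nat \<Rightarrow> 'w measure" and \<omega> +
  fixes S :: "nat \<Rightarrow> 'v set set set"
    and m :: "nat \<Rightarrow> nat \<Rightarrow> nat \<Rightarrow> nat"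
    and \<gamma> :: "nat \<Rightarrow> nat \<Rightarrow> real"
  assumes S_nonempty: "\<And>n. S n \<noteq> {}"
    and S_subgraphs: "\<And>n. S n \<subseteq> Pow (block_edges L B n)"
    and edge_counts:
      "\<And>n s t \<pi>. (s, t) \<in> block_pairs L \<Longrightarrow> \<pi> \<in> S n \<Longrightarrow>
         card (\<pi> \<inter> edges_between (B n s) (B n t)) = m n s t"
    and gamma_pos: "\<And>s t. (s, t) \<in> block_pairs L \<Longrightarrow> 0 < \<gamma> s t"
    and edge_counts_limit:
      "\<And>s t. (s, t) \<in> block_pairs L \<Longrightarrow>
         (\<lambda>n. (real (m n s t))\<^sup>2 / (2 * real (card (edges_between (B n s) (B n t)))))
           \<longlonglongrightarrow> \<gamma> s t"
    and matchings_extend: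
      "\<And>n \<Gamma>. \<Gamma> \<subseteq> block_edges L B n \<Longrightarrow> partial_matching \<Gamma> \<Longrightarrow> \<exists>\<pi>\<in>S n. \<Gamma> \<subseteq> \<pi>"
    and matching_probabilities:
      "\<exists>\<rho>>0. \<forall>n k \<Gamma>. \<Gamma> \<subseteq> block_edges L B n \<and> partial_matching \<Gamma> \<and> card \<Gamma> = k \<longrightarrow>
         \<bar>measure_pmf.prob (pmf_of_set (S n)) {\<pi>. \<Gamma> \<subseteq> \<pi>} /
           (\<Prod>e\<in>\<Gamma>. measure_pmf.prob (pmf_of_set (S n)) {\<pi>. e \<in> \<pi>}) - 1\<bar>
         \<le> \<rho> ^ k / sqrt (real (\<Sum>(s, t)\<in>block_pairs L. m n s t))"
    and nonmatching_probabilities: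
      "\<exists>\<rho>>0. \<forall>n k \<Gamma>. (\<exists>\<pi>\<in>S n. \<Gamma> \<subseteq> \<pi>) \<and> \<not> partial_matching \<Gamma> \<and> card \<Gamma> = k \<longrightarrow>
         measure_pmf.prob (pmf_of_set (S n)) {\<pi>. \<Gamma> \<subseteq> \<pi>}
         \<le> \<rho> ^ k * (\<Prod>e\<in>\<Gamma>. measure_pmf.prob (pmf_of_set (S n)) {\<pi>. e \<in> \<pi>})"
    and edge_probabilities:
      "\<And>n s t e. (s, t) \<in> block_pairs L \<Longrightarrow> e \<in> edges_between (B n s) (B n t) \<Longrightarrow>
         measure_pmf.prob (pmf_of_set (S n)) {\<pi>. e \<in> \<pi>} =
           real (m n s t) / real (card (edges_between (B n s) (B n t)))"

end

theory Submission
  imports Defs "HOL-Real_Asymp.Real_Asymp"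
begin

text \<open>After division by the exponentials of \<open>\<psi>\<close>, each Boltzmann factor becomes \<open>1 + \<xi>\<^sub>e\<close> with
  independent centered \<open>\<xi>\<^sub>e\<close> of variance \<open>v\<^sup>2\<close>, and the normalized partition function expands as
  \<open>\<Sum>\<^sub>\<Gamma> P(\<Gamma> \<subseteq> \<pi>) \<Prod>\<^sub>e\<^sub>\<in>\<^sub>\<Gamma> \<xi>\<^sub>e\<close>, a sum of orthogonal terms. Its \<open>L\<^sup>2\<close> distance to the product
  \<open>\<Prod>\<^sub>e (1 + p\<^sub>e \<xi>\<^sub>e) = \<Sum>\<^sub>\<Gamma> \<Prod>\<^sub>e\<^sub>\<in>\<^sub>\<Gamma> p\<^sub>e \<xi>\<^sub>e\<close> tends to \<open>0\<close>: matchings contribute \<open>O(1/m)\<close>, and every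
  other \<open>\<Gamma>\<close> contains one of at most \<open>2n\<^sup>3\<close> pairs of adjacent edges, each of weight \<open>O(n\<^sup>-\<^sup>4)\<close>. The logarithm of the
  product is a sum of independent variables, and its characteristic function converges to that of
  the normal limit because \<open>E (1 + p \<xi>)\<^sup>i\<^sup>t = 1 - (t\<^sup>2 + i t) p\<^sup>2 v\<^sup>2 / 2 + o(p\<^sup>2)\<close>.\<close>

section \<open>The normal law and stability of convergence in distribution\<close>

text \<open>An affine image of the standard normal law also covers the degenerate case
  \<open>v = 0\<close>, where it is the point mass, so the characteristic function below needs no
  case distinction.\<close>

lemma normal_law_eq_distr:
  assumes "0 \<le> v"
  shows "normal_law \<mu> v = distr std_normal_distribution borel (\<lambda>x. \<mu> + sqrt v * x)"
proof (cases "v = 0")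
  case True
  interpret prob_space std_normal_distribution
    by (rule prob_space_normal_density) simp
  show ?thesis
    using True by (simp add: normal_law_def)
next
  case False
  then have v: "0 < sqrt v" using assms by simp
  interpret prob_space std_normal_distribution
    by (rule prob_space_normal_density) simp
  have "distributed std_normal_distribution lborel (\<lambda>x. \<mu> + sqrt v * x) (normal_density \<mu> (sqrt v))"
    unfolding normal_standard_normal_convert[OF v]
    using v False by (auto simp: distributed_def distr_id2)
  then have "distr std_normal_distribution lborel (\<lambda>x. \<mu> + sqrt v * x) = density lborel (normal_density \<mu> (sqrt v))"
    by (rule distributed_distr_eq_density)
  moreover have "distr std_normal_distribution lborel (\<lambda>x. \<mu> + sqrt v * x)
      = distr std_normal_distribution borel (\<lambda>x. \<mu> + sqrt v * x)"
    by (rule distr_cong) auto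
  ultimately show ?thesis using False by (simp add: normal_law_def)
qed

lemma real_distribution_normal_law:
  assumes "0 \<le> v"
  shows "real_distribution (normal_law \<mu> v)"
proof -
  interpret prob_space std_normal_distribution
    by (rule prob_space_normal_density) simp
  show ?thesis unfolding normal_law_eq_distr[OF assms] by simp
qed

lemma char_normal_law:
  assumes "0 \<le> v"
  shows "char (normal_law \<mu> v) t = exp (\<i> * of_real (t * \<mu>) - of_real (v * t\<^sup>2 / 2))"
proof -
  have "char (normal_law \<mu> v) t = (CLINT x|std_normal_distribution. iexp (t * \<mu>) * iexp (t * sqrt v * x))"
    unfolding normal_law_eq_distr[OF assms] char_def
    by (subst integral_distr) (auto simp: exp_add[symmetric] algebra_simps)
  also have "\<dots> = iexp (t * \<mu>) * char std_normal_distribution (t * sqrt v)"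
    by (simp add: char_def)
  also have "\<dots> = iexp (t * \<mu>) * of_real (exp (- (v * t\<^sup>2 / 2)))"
    using assms unfolding char_std_normal_distribution power_mult_distrib by (simp add: mult.commute)
  also have "\<dots> = exp (\<i> * of_real (t * \<mu>) - of_real (v * t\<^sup>2 / 2))"
    unfolding exp_of_real[symmetric] exp_add[symmetric] by simp
  finally show ?thesis .
qed

section \<open>Transfer of convergence in distribution to a perturbation of
  \<open>exp Y\<close>\<close>

lemma (in real_distribution) continuity_point_between:
  assumes "a < b"
  obtains y where "a < y" "y < b" "isCont (cdf M) y"
proof -
  \<comment> \<open>A monotone function has only countably many discontinuities, while an open
    interval is uncountable.\<close>
  have "countable {y. \<not> isCont (cdf M) y}"
    by (intro mono_ctble_discont monoI cdf_nondecreasing)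
  then have "\<not> {a<..<b} \<subseteq> {y. \<not> isCont (cdf M) y}"
    using assms uncountable_open_interval countable_subset by blast
  then show thesis using that by force
qed

text \<open>A Slutsky argument on the exponential scale. No logarithm of \<open>U\<close> is taken,
  because \<open>U\<close> need not be positive. The point \<open>x\<close> is replaced by a nearby
  continuity point \<open>y\<close>, on the right for the upper bound and on the left for the lower
  one; the two events then differ only if \<open>U\<close> and \<open>exp Y\<close> are at least
  \<open>\<bar>exp y - exp x\<bar>\<close> apart, which has vanishing probability.\<close>

lemma prob_le_exp_tendsto:
  fixes Y U :: "nat \<Rightarrow> 'w \<Rightarrow> real"
  assumes prob: "\<And>n. prob_space (M n)"
    and Y: "\<And>n. Y n \<in> borel_measurable (M n)"
    and U: "\<And>n. U n \<in> borel_measurable (M n)"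
    and \<mu>: "real_distribution \<mu>"
    and weak: "weak_conv_m (\<lambda>n. distr (M n) borel (Y n)) \<mu>"
    and close: "\<And>\<epsilon>. 0 < \<epsilon> \<Longrightarrow> (\<lambda>n. \<P>(\<omega> in M n. \<bar>U n \<omega> - exp (Y n \<omega>)\<bar> \<ge> \<epsilon>)) \<longlonglongrightarrow> 0"
    and cont: "isCont (cdf \<mu>) x"
  shows "(\<lambda>n. \<P>(\<omega> in M n. U n \<omega> \<le> exp x)) \<longlonglongrightarrow> cdf \<mu> x"
proof -
  interpret \<mu>: real_distribution \<mu> by fact
  note [measurable] = Y U
  have cdf_Y: "cdf (distr (M n) borel (Y n)) y = \<P>(\<omega> in M n. Y n \<omega> \<le> y)" for n y
    by (simp add: cdf_def measure_distr vimage_def Int_def conj_commute)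
  have conv: "(\<lambda>n. \<P>(\<omega> in M n. Y n \<omega> \<le> y)) \<longlonglongrightarrow> cdf \<mu> y" if "isCont (cdf \<mu>) y" for y
    using weak that unfolding weak_conv_m_def weak_conv_def cdf_Y by blast
  have upper: "eventually (\<lambda>n. \<P>(\<omega> in M n. U n \<omega> \<le> exp x) < cdf \<mu> x + \<delta>) sequentially" if "0 < \<delta>" for \<delta>
  proof -
    have "eventually (\<lambda>y. cdf \<mu> y < cdf \<mu> x + \<delta>/2) (at x)"
      using cont that unfolding isCont_def by (intro order_tendstoD) auto
    then obtain d where d: "0 < d" "\<And>y. y \<noteq> x \<Longrightarrow> dist y x < d \<Longrightarrow> cdf \<mu> y < cdf \<mu> x + \<delta>/2"
      unfolding eventually_at by auto
    obtain y where y: "x < y" "y < x + d" "isCont (cdf \<mu>) y"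
      using \<mu>.continuity_point_between[of x "x + d"] d by auto
    have Fy: "cdf \<mu> y < cdf \<mu> x + \<delta>/2"
      using d(2)[of y] y by (auto simp: dist_real_def)
    \<comment> \<open>If \<open>U \<le> exp x\<close> and the deviation stays below this gap, then
      \<open>exp Y < exp y\<close>.\<close>
    let ?e = "exp y - exp x"
    have e: "0 < ?e" using y by simp
    have "eventually (\<lambda>n. \<P>(\<omega> in M n. Y n \<omega> \<le> y) < cdf \<mu> x + \<delta>/2) sequentially"
      using conv[OF y(3)] Fy by (rule order_tendstoD)
    moreover have "eventually (\<lambda>n. \<P>(\<omega> in M n. \<bar>U n \<omega> - exp (Y n \<omega>)\<bar> \<ge> ?e) < \<delta>/2) sequentially"
      using close[OF e] that by (intro order_tendstoD(2)) auto
    ultimately show ?thesis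
    proof eventually_elim
      case (elim n)
      interpret prob_space "M n" by (rule prob)
      have "prob {\<omega> \<in> space (M n). U n \<omega> \<le> exp x}
          \<le> prob ({\<omega> \<in> space (M n). Y n \<omega> \<le> y} \<union> {\<omega> \<in> space (M n). \<bar>U n \<omega> - exp (Y n \<omega>)\<bar> \<ge> ?e})"
      proof (rule finite_measure_mono)
        show "{\<omega> \<in> space (M n). U n \<omega> \<le> exp x}
          \<subseteq> {\<omega> \<in> space (M n). Y n \<omega> \<le> y} \<union> {\<omega> \<in> space (M n). \<bar>U n \<omega> - exp (Y n \<omega>)\<bar> \<ge> ?e}"
        proof safe
          fix \<omega> assume *: "U n \<omega> \<le> exp x" "\<not> ?e \<le> \<bar>U n \<omega> - exp (Y n \<omega>)\<bar>"
          then have "exp (Y n \<omega>) < exp y" by linarith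
          then show "Y n \<omega> \<le> y" by simp
        qed
      qed measurable
      also have "\<dots> \<le> prob {\<omega> \<in> space (M n). Y n \<omega> \<le> y} + prob {\<omega> \<in> space (M n). \<bar>U n \<omega> - exp (Y n \<omega>)\<bar> \<ge> ?e}"
        by (rule measure_Un_le) measurable
      finally show ?case using elim by simp
    qed
  qed
  have lower: "eventually (\<lambda>n. cdf \<mu> x - \<delta> < \<P>(\<omega> in M n. U n \<omega> \<le> exp x)) sequentially" if "0 < \<delta>" for \<delta>
  proof -
    have "eventually (\<lambda>y. cdf \<mu> x - \<delta>/2 < cdf \<mu> y) (at x)"
      using cont that unfolding isCont_def by (intro order_tendstoD) auto
    then obtain d where d: "0 < d" "\<And>y. y \<noteq> x \<Longrightarrow> dist y x < d \<Longrightarrow> cdf \<mu> x - \<delta>/2 < cdf \<mu> y"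
      unfolding eventually_at by auto
    obtain y where y: "x - d < y" "y < x" "isCont (cdf \<mu>) y"
      using \<mu>.continuity_point_between[of "x - d" x] d by auto
    have Fy: "cdf \<mu> x - \<delta>/2 < cdf \<mu> y"
      using d(2)[of y] y by (auto simp: dist_real_def)
    let ?e = "exp x - exp y"
    have e: "0 < ?e" using y by simp
    have "eventually (\<lambda>n. cdf \<mu> x - \<delta>/2 < \<P>(\<omega> in M n. Y n \<omega> \<le> y)) sequentially"
      using conv[OF y(3)] Fy by (rule order_tendstoD)
    moreover have "eventually (\<lambda>n. \<P>(\<omega> in M n. \<bar>U n \<omega> - exp (Y n \<omega>)\<bar> \<ge> ?e) < \<delta>/2) sequentially"
      using close[OF e] that by (intro order_tendstoD(2)) auto
    ultimately show ?thesis
    proof eventually_elim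
      case (elim n)
      interpret prob_space "M n" by (rule prob)
      have "prob {\<omega> \<in> space (M n). Y n \<omega> \<le> y}
          \<le> prob ({\<omega> \<in> space (M n). U n \<omega> \<le> exp x} \<union> {\<omega> \<in> space (M n). \<bar>U n \<omega> - exp (Y n \<omega>)\<bar> \<ge> ?e})"
      proof (rule finite_measure_mono)
        show "{\<omega> \<in> space (M n). Y n \<omega> \<le> y}
          \<subseteq> {\<omega> \<in> space (M n). U n \<omega> \<le> exp x} \<union> {\<omega> \<in> space (M n). \<bar>U n \<omega> - exp (Y n \<omega>)\<bar> \<ge> ?e}"
        proof safe
          fix \<omega> assume *: "Y n \<omega> \<le> y" "\<not> ?e \<le> \<bar>U n \<omega> - exp (Y n \<omega>)\<bar>"
          then have "exp (Y n \<omega>) \<le> exp y" by simp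
          then show "U n \<omega> \<le> exp x" using * by linarith
        qed
      qed measurable
      also have "\<dots> \<le> prob {\<omega> \<in> space (M n). U n \<omega> \<le> exp x} + prob {\<omega> \<in> space (M n). \<bar>U n \<omega> - exp (Y n \<omega>)\<bar> \<ge> ?e}"
        by (rule measure_Un_le) measurable
      finally show ?case using elim by simp
    qed
  qed
  show ?thesis
  proof (rule order_tendstoI)
    fix a assume "a < cdf \<mu> x"
    then show "eventually (\<lambda>n. a < \<P>(\<omega> in M n. U n \<omega> \<le> exp x)) sequentially"
      using lower[of "cdf \<mu> x - a"] by simp
  next
    fix a assume "cdf \<mu> x < a"
    then show "eventually (\<lambda>n. \<P>(\<omega> in M n. U n \<omega> \<le> exp x) < a) sequentially"
      using upper[of "a - cdf \<mu> x"] by simp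
  qed
qed

text \<open>The second-order remainder of \<open>y \<mapsto> (1 + y) powr (\<i> t)\<close> at \<open>0\<close>, divided by \<open>y\<^sup>2\<close>
  and extended continuously to \<open>y = 0\<close>.\<close>

definition log_remainder :: "real \<Rightarrow> real \<Rightarrow> complex" where
  "log_remainder t y = (if y = 0 then - (of_real (t\<^sup>2) + \<i> * of_real t) / 2
     else (iexp (t * ln (1 + y)) - 1 - \<i> * of_real (t * y)) / of_real (y\<^sup>2))"

text \<open>This merely undoes the division in \<open>log_remainder\<close>, so it holds for every
  real \<open>y\<close>; at \<open>y = 0\<close> both sides equal 1 whatever value was chosen
  there.\<close>

lemma iexp_ln_expansion:
  "iexp (t * ln (1 + y)) = 1 + \<i> * of_real (t * y) + of_real (y\<^sup>2) * log_remainder t y"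
  by (simp add: log_remainder_def)

text \<open>With \<open>u = ln (1 + y)\<close>, the numerator is the first-order remainder of
  \<open>iexp\<close> at \<open>t * u\<close> plus \<open>\<i> * t * (u - y)\<close>. The bounds
  \<open>\<bar>u\<bar> \<le> 2 * \<bar>y\<bar>\<close> and
  \<open>\<bar>u - y\<bar> \<le> 2 * y^2\<close> make both parts of order \<open>y^2\<close>. There
  is no upper restriction on \<open>y\<close>, so the bound can dominate an expectation over
  unbounded variables.\<close>

lemma norm_log_remainder_le:
  assumes "- 1 / 2 \<le> y"
  shows "norm (log_remainder t y) \<le> 2 * t\<^sup>2 + 2 * \<bar>t\<bar>"
proof (cases "y = 0")
  case True
  have "norm (log_remainder t y) = norm (complex_of_real (t\<^sup>2) + \<i> * of_real t) / 2"
    unfolding log_remainder_def if_P[OF True] norm_divide norm_minus_cancel by simp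
  also have "\<dots> \<le> (t\<^sup>2 + \<bar>t\<bar>) / 2"
    by (intro divide_right_mono norm_triangle_le) (simp_all add: norm_mult del: of_real_power)
  also have "\<dots> \<le> 2 * t\<^sup>2 + 2 * \<bar>t\<bar>"
    by (simp add: field_simps)
  finally show ?thesis .
next
  case False
  define u where "u = ln (1 + y)"
  have u1: "\<bar>u - y\<bar> \<le> 2 * y\<^sup>2"
  proof (cases "\<bar>y\<bar> \<le> 1 / 2")
    case True then show ?thesis unfolding u_def by (rule abs_ln_one_plus_x_minus_x_bound)
  next
    case False
    \<comment> \<open>Beyond \<open>1/2\<close> the linear bound
      \<open>\<bar>u - y\<bar> \<le> y\<close> suffices, since \<open>y \<le> 2 * y^2\<close>
      there.\<close>
    then have y: "1/2 < y" using assms by auto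
    have "0 \<le> u" "u \<le> y" using y ln_add_one_self_le_self[of y] by (auto simp: u_def)
    then have "\<bar>u - y\<bar> \<le> y * 1" by auto
    also have "\<dots> \<le> y * (2 * y)" using y by (intro mult_left_mono) auto
    finally show ?thesis by (simp add: power2_eq_square)
  qed
  have u2: "\<bar>u\<bar> \<le> 2 * \<bar>y\<bar>"
  proof (cases "0 \<le> y")
    case True then show ?thesis using ln_add_one_self_le_self[of y] by (simp add: u_def)
  next
    case False
    then have "\<bar>u - y\<bar> \<le> \<bar>y\<bar>"
      using u1 assms mult_right_mono[of "2 * \<bar>y\<bar>" 1 "\<bar>y\<bar>"] by (simp add: power2_eq_square abs_mult[symmetric])
    then show ?thesis by linarith
  qed
  have *: "iexp (t * u) - 1 - \<i> * of_real (t * y) = (iexp (t * u) - (1 + \<i> * of_real (t * u))) + \<i> * of_real (t * (u - y))"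
    by (simp add: algebra_simps)
  have "norm (iexp (t * u) - 1 - \<i> * of_real (t * y)) \<le> (t * u)\<^sup>2 / 2 + \<bar>t * (u - y)\<bar>"
    unfolding * using iexp_approx1[of "t * u" 1]
    by (intro norm_triangle_mono) (simp_all add: norm_mult numeral_2_eq_2 del: of_real_mult of_real_diff)
  also have "\<dots> \<le> (\<bar>t\<bar> * (2 * \<bar>y\<bar>))\<^sup>2 / 2 + \<bar>t\<bar> * (2 * y\<^sup>2)"
    unfolding abs_mult using u1 u2
    by (intro add_mono divide_right_mono mult_left_mono abs_le_square_iff[THEN iffD1])
       (auto simp: abs_mult mult_left_mono)
  also have "\<dots> = (2 * t\<^sup>2 + 2 * \<bar>t\<bar>) * y\<^sup>2"
    by (simp add: algebra_simps)
  finally show ?thesis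
    using False by (simp add: log_remainder_def u_def norm_divide norm_power pos_divide_le_eq)
qed

text \<open>From \<open>ln (1 + y) = y - y^2 / 2 + ...\<close>, the real part of the numerator
  behaves like \<open>- t^2 * y^2 / 2\<close> and the imaginary part like
  \<open>- t * y^2 / 2\<close>.\<close>

lemma isCont_log_remainder: "isCont (log_remainder t) 0"
proof -
  have re: "((\<lambda>y. (cos (t * ln (1 + y)) - 1) / y\<^sup>2) \<longlongrightarrow> - t\<^sup>2 / 2) (at (0::real))"
    by (real_asymp simp: power2_eq_square)
  have im: "((\<lambda>y. (sin (t * ln (1 + y)) - t * y) / y\<^sup>2) \<longlongrightarrow> - t / 2) (at (0::real))"
    by real_asymp
  have lim: "((\<lambda>y. Complex ((cos (t * ln (1 + y)) - 1) / y\<^sup>2) ((sin (t * ln (1 + y)) - t * y) / y\<^sup>2))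
     \<longlongrightarrow> Complex (- t\<^sup>2 / 2) (- t / 2)) (at (0::real))"
    by (rule tendsto_Complex[OF re im])
  have eq: "Complex (- t\<^sup>2 / 2) (- t / 2) = log_remainder t 0"
    by (simp add: log_remainder_def complex_eq_iff)
  have "Complex ((cos (t * ln (1 + y)) - 1) / y\<^sup>2) ((sin (t * ln (1 + y)) - t * y) / y\<^sup>2)
      = log_remainder t y" if "y \<noteq> 0" for y
    using that by (simp add: log_remainder_def complex_eq_iff Re_exp Im_exp del: of_real_power)
  then have "eventually (\<lambda>y. Complex ((cos (t * ln (1 + y)) - 1) / y\<^sup>2) ((sin (t * ln (1 + y)) - t * y) / y\<^sup>2)
      = log_remainder t y) (at (0::real))"
    by (simp add: eventually_at_filter)
  from Lim_transform_eventually[OF lim this] show ?thesis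
    unfolding isCont_def eq .
qed

lemma borel_measurable_log_remainder [measurable]: "log_remainder t \<in> borel_measurable borel"
  unfolding log_remainder_def by measurable

section \<open>Orthogonal expansions over edge sets\<close>

context prob_space
begin

context
  fixes X :: "'e \<Rightarrow> 'a \<Rightarrow> real" and v :: "'e \<Rightarrow> real" and E :: "'e set"
  assumes indep: "indep_vars (\<lambda>_. borel) X E" and fin: "finite E"
    and sq: "\<And>e. e \<in> E \<Longrightarrow> integrable M (\<lambda>\<omega>. (X e \<omega>)\<^sup>2)"
    and mean: "\<And>e. e \<in> E \<Longrightarrow> expectation (X e) = 0"
    and var: "\<And>e. e \<in> E \<Longrightarrow> expectation (\<lambda>\<omega>. (X e \<omega>)\<^sup>2) = v e"
begin

text \<open>Orthogonality of the monomials: by independence the expectation factors over the edges.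
  If the two sets differ, some edge lies in exactly one of them and contributes its mean, which is
  0.\<close>

lemma prod_mult_prod_moment:
  assumes "\<Gamma> \<subseteq> E" "\<Delta> \<subseteq> E"
  shows "integrable M (\<lambda>\<omega>. (\<Prod>e\<in>\<Gamma>. X e \<omega>) * (\<Prod>e\<in>\<Delta>. X e \<omega>))"
    and "expectation (\<lambda>\<omega>. (\<Prod>e\<in>\<Gamma>. X e \<omega>) * (\<Prod>e\<in>\<Delta>. X e \<omega>)) = (if \<Gamma> = \<Delta> then (\<Prod>e\<in>\<Gamma>. v e) else 0)"
proof -
  \<comment> \<open>The factor of a single edge: \<open>x^2\<close>, \<open>x\<close> or
    \<open>1\<close> according to whether it lies in both sets, in one or in none. Both products
    become one product over \<open>E\<close>.\<close>
  define f where "f e x = (if e \<in> \<Gamma> then x else 1) * (if e \<in> \<Delta> then x else 1)" for e and x :: real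
  have X: "random_variable borel (X e)" if "e \<in> E" for e
    using indep that by (auto simp: indep_vars_def)
  have int: "integrable M (X e)" if "e \<in> E" for e
    using square_integrable_imp_integrable X sq that by blast
  have f_indep: "indep_vars (\<lambda>_. borel) (\<lambda>e \<omega>. f e (X e \<omega>)) E"
    by (rule indep_vars_compose2[OF indep]) (simp add: f_def)
  have f_int: "integrable M (\<lambda>\<omega>. f e (X e \<omega>))" if "e \<in> E" for e
    using int[OF that] sq[OF that] by (cases "e \<in> \<Gamma>"; cases "e \<in> \<Delta>") (auto simp: f_def power2_eq_square)
  have f_exp: "expectation (\<lambda>\<omega>. f e (X e \<omega>)) = (if e \<in> \<Gamma> \<inter> \<Delta> then v e else if e \<in> \<Gamma> \<union> \<Delta> then 0 else 1)"
    if "e \<in> E" for e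
    using mean[OF that] var[OF that]
    by (cases "e \<in> \<Gamma>"; cases "e \<in> \<Delta>") (auto simp: f_def power2_eq_square prob_space)
  have restrict: "(\<Prod>e\<in>A. g e) = (\<Prod>e\<in>E. if e \<in> A then g e else 1)" if "A \<subseteq> E" for A and g :: "'e \<Rightarrow> real"
    using prod.inter_restrict[OF fin, of g A] that by (simp add: Int_absorb1)
  have eq: "(\<Prod>e\<in>\<Gamma>. X e \<omega>) * (\<Prod>e\<in>\<Delta>. X e \<omega>) = (\<Prod>e\<in>E. f e (X e \<omega>))" for \<omega>
    unfolding f_def prod.distrib by (simp only: restrict[OF assms(1)] restrict[OF assms(2)])
  show "integrable M (\<lambda>\<omega>. (\<Prod>e\<in>\<Gamma>. X e \<omega>) * (\<Prod>e\<in>\<Delta>. X e \<omega>))"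
    unfolding eq by (rule indep_vars_integrable[OF fin f_indep f_int])
  have "expectation (\<lambda>\<omega>. (\<Prod>e\<in>\<Gamma>. X e \<omega>) * (\<Prod>e\<in>\<Delta>. X e \<omega>))
      = (\<Prod>e\<in>E. if e \<in> \<Gamma> \<inter> \<Delta> then v e else if e \<in> \<Gamma> \<union> \<Delta> then 0 else 1)"
    unfolding eq using f_exp by (subst indep_vars_lebesgue_integral[OF fin f_indep f_int]) auto
  also have "\<dots> = (if \<Gamma> = \<Delta> then (\<Prod>e\<in>\<Gamma>. v e) else 0)"
  proof (cases "\<Gamma> = \<Delta>")
    case True
    then show ?thesis using restrict[OF assms(1), of v] by (simp cong: if_cong)
  next
    case False
    then obtain e where "e \<in> E" "e \<notin> \<Gamma> \<inter> \<Delta>" "e \<in> \<Gamma> \<union> \<Delta>" using assms by blast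
    then have "(\<Prod>e\<in>E. if e \<in> \<Gamma> \<inter> \<Delta> then v e else if e \<in> \<Gamma> \<union> \<Delta> then 0 else 1) = 0"
      by (intro prod_zero[OF fin] bexI[of _ e]) auto
    then show ?thesis using False by simp
  qed
  finally show "expectation (\<lambda>\<omega>. (\<Prod>e\<in>\<Gamma>. X e \<omega>) * (\<Prod>e\<in>\<Delta>. X e \<omega>)) = (if \<Gamma> = \<Delta> then (\<Prod>e\<in>\<Gamma>. v e) else 0)" .
qed

text \<open>Parseval's identity for the orthogonal monomials: after expanding the square only the
  diagonal terms survive.\<close>

lemma multilinear_second_moment:
  fixes c :: "'e set \<Rightarrow> real"
  shows "integrable M (\<lambda>\<omega>. (\<Sum>\<Gamma>\<in>Pow E. c \<Gamma> * (\<Prod>e\<in>\<Gamma>. X e \<omega>))\<^sup>2)"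
    and "expectation (\<lambda>\<omega>. (\<Sum>\<Gamma>\<in>Pow E. c \<Gamma> * (\<Prod>e\<in>\<Gamma>. X e \<omega>))\<^sup>2) = (\<Sum>\<Gamma>\<in>Pow E. (c \<Gamma>)\<^sup>2 * (\<Prod>e\<in>\<Gamma>. v e))"
proof -
  have eq: "(\<Sum>\<Gamma>\<in>Pow E. c \<Gamma> * (\<Prod>e\<in>\<Gamma>. X e \<omega>))\<^sup>2
     = (\<Sum>\<Gamma>\<in>Pow E. \<Sum>\<Delta>\<in>Pow E. c \<Gamma> * c \<Delta> * ((\<Prod>e\<in>\<Gamma>. X e \<omega>) * (\<Prod>e\<in>\<Delta>. X e \<omega>)))" for \<omega>
    by (simp add: power2_eq_square sum_product mult_ac)
  have int: "integrable M (\<lambda>\<omega>. c \<Gamma> * c \<Delta> * ((\<Prod>e\<in>\<Gamma>. X e \<omega>) * (\<Prod>e\<in>\<Delta>. X e \<omega>)))"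
    if "\<Gamma> \<in> Pow E" "\<Delta> \<in> Pow E" for \<Gamma> \<Delta>
    using that by (intro integrable_mult_right prod_mult_prod_moment) auto
  show "integrable M (\<lambda>\<omega>. (\<Sum>\<Gamma>\<in>Pow E. c \<Gamma> * (\<Prod>e\<in>\<Gamma>. X e \<omega>))\<^sup>2)"
    unfolding eq by (intro Bochner_Integration.integrable_sum int)
  have "expectation (\<lambda>\<omega>. (\<Sum>\<Gamma>\<in>Pow E. c \<Gamma> * (\<Prod>e\<in>\<Gamma>. X e \<omega>))\<^sup>2)
     = (\<Sum>\<Gamma>\<in>Pow E. \<Sum>\<Delta>\<in>Pow E. c \<Gamma> * c \<Delta> * expectation (\<lambda>\<omega>. (\<Prod>e\<in>\<Gamma>. X e \<omega>) * (\<Prod>e\<in>\<Delta>. X e \<omega>)))"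
    unfolding eq
    by (simp only: Bochner_Integration.integral_sum[OF Bochner_Integration.integrable_sum[OF int]]
      Bochner_Integration.integral_sum[OF int] integral_mult_right_zero cong: sum.cong)
  also have "\<dots> = (\<Sum>\<Gamma>\<in>Pow E. \<Sum>\<Delta>\<in>Pow E. if \<Gamma> = \<Delta> then c \<Gamma> * c \<Delta> * (\<Prod>e\<in>\<Gamma>. v e) else 0)"
    by (intro sum.cong refl) (auto simp: prod_mult_prod_moment(2))
  also have "\<dots> = (\<Sum>\<Gamma>\<in>Pow E. (c \<Gamma>)\<^sup>2 * (\<Prod>e\<in>\<Gamma>. v e))"
    using fin by (simp add: power2_eq_square)
  finally show "expectation (\<lambda>\<omega>. (\<Sum>\<Gamma>\<in>Pow E. c \<Gamma> * (\<Prod>e\<in>\<Gamma>. X e \<omega>))\<^sup>2) = (\<Sum>\<Gamma>\<in>Pow E. (c \<Gamma>)\<^sup>2 * (\<Prod>e\<in>\<Gamma>. v e))" .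
qed

end

end

section \<open>Sums of products over the subsets of a finite set\<close>

lemma sum_Pow_prod:
  fixes q :: "'e \<Rightarrow> 'b::comm_semiring_1"
  assumes "finite E"
  shows "(\<Sum>\<Gamma>\<in>Pow E. \<Prod>e\<in>\<Gamma>. q e) = (\<Prod>e\<in>E. 1 + q e)"
  using prod_add[OF assms, of q "\<lambda>_. 1"] by (simp add: add.commute)

lemma sum_Pow_prod_le_exp:
  fixes q :: "'e \<Rightarrow> real"
  assumes "finite E" "\<And>e. e \<in> E \<Longrightarrow> 0 \<le> q e"
  shows "(\<Sum>\<Gamma>\<in>Pow E. \<Prod>e\<in>\<Gamma>. q e) \<le> exp (\<Sum>e\<in>E. q e)"
  unfolding sum_Pow_prod[OF assms(1)] exp_sum[OF assms(1)]
  using assms(2) by (intro prod_mono) auto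

text \<open>Deleting \<open>e\<close> and \<open>f\<close> is injective on the sets containing both
  and splits off the factor \<open>q e * q f\<close>; the remaining products are among those of the
  full sum over subsets.\<close>

lemma sum_Pow_prod_pair_le:
  fixes q :: "'e \<Rightarrow> real"
  assumes fin: "finite E" and q: "\<And>e. e \<in> E \<Longrightarrow> 0 \<le> q e" and ef: "e \<in> E" "f \<in> E" "e \<noteq> f"
  shows "(\<Sum>\<Gamma> | \<Gamma> \<subseteq> E \<and> e \<in> \<Gamma> \<and> f \<in> \<Gamma>. \<Prod>g\<in>\<Gamma>. q g) \<le> q e * q f * exp (\<Sum>g\<in>E. q g)"
proof -
  let ?A = "{\<Gamma>. \<Gamma> \<subseteq> E \<and> e \<in> \<Gamma> \<and> f \<in> \<Gamma>}"
  have inj: "inj_on (\<lambda>\<Gamma>. \<Gamma> - {e, f}) ?A"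
    by (auto simp: inj_on_def)
  have split: "(\<Prod>g\<in>\<Gamma>. q g) = q e * q f * (\<Prod>g\<in>\<Gamma> - {e, f}. q g)" if "\<Gamma> \<in> ?A" for \<Gamma>
  proof -
    have "finite \<Gamma>" using that fin finite_subset by auto
    then show ?thesis
      using that ef prod.subset_diff[of "{e, f}" \<Gamma> q] by (simp add: mult.commute)
  qed
  have "(\<Sum>\<Gamma>\<in>?A. \<Prod>g\<in>\<Gamma>. q g) = q e * q f * (\<Sum>\<Gamma>\<in>?A. \<Prod>g\<in>\<Gamma> - {e, f}. q g)"
    unfolding sum_distrib_left using split by (intro sum.cong) auto
  also have "(\<Sum>\<Gamma>\<in>?A. \<Prod>g\<in>\<Gamma> - {e, f}. q g) = (\<Sum>\<Gamma>\<in>(\<lambda>\<Gamma>. \<Gamma> - {e, f}) ` ?A. \<Prod>g\<in>\<Gamma>. q g)"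
    by (simp add: sum.reindex[OF inj])
  also have "\<dots> \<le> (\<Sum>\<Gamma>\<in>Pow E. \<Prod>g\<in>\<Gamma>. q g)"
    using fin q by (intro sum_mono2 prod_nonneg) auto
  also have "\<dots> \<le> exp (\<Sum>g\<in>E. q g)"
    using fin q by (rule sum_Pow_prod_le_exp)
  finally show ?thesis using q ef by (simp add: mult_left_mono)
qed

text \<open>\<open>T\<close> lists the pairs that spoil a set; in the application they are the
  adjacent edges. Squaring turns \<open>R ^ card \<Gamma>\<close> into a factor \<open>R^2\<close>
  per edge, so every estimate is a product of \<open>q\<close>. Sets without a pair from
  \<open>T\<close> contribute at most \<open>\<delta>^2\<close> times such a product; the others are
  charged to the pairs they contain, by a union bound.\<close>

lemma sum_Pow_squared_difference_le:
  fixes p v :: "'e \<Rightarrow> real" and P :: "'e set \<Rightarrow> real"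
  assumes fin: "finite E" and p: "\<And>e. e \<in> E \<Longrightarrow> 0 \<le> p e" and v: "\<And>e. e \<in> E \<Longrightarrow> 0 \<le> v e"
    and R: "1 \<le> R"
    and T: "T \<subseteq> E \<times> E" "\<And>e f. (e, f) \<in> T \<Longrightarrow> e \<noteq> f"
    and close: "\<And>\<Gamma>. \<Gamma> \<subseteq> E \<Longrightarrow> (\<And>e f. (e, f) \<in> T \<Longrightarrow> \<not> (e \<in> \<Gamma> \<and> f \<in> \<Gamma>)) \<Longrightarrow>
        \<bar>P \<Gamma> - (\<Prod>e\<in>\<Gamma>. p e)\<bar> \<le> \<delta> * (R ^ card \<Gamma> * (\<Prod>e\<in>\<Gamma>. p e))"
    and bound: "\<And>\<Gamma>. \<Gamma> \<subseteq> E \<Longrightarrow> 0 \<le> P \<Gamma>"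
        "\<And>\<Gamma> e f. \<Gamma> \<subseteq> E \<Longrightarrow> (e, f) \<in> T \<Longrightarrow> e \<in> \<Gamma> \<Longrightarrow> f \<in> \<Gamma> \<Longrightarrow> P \<Gamma> \<le> R ^ card \<Gamma> * (\<Prod>e\<in>\<Gamma>. p e)"
  defines "q \<equiv> \<lambda>e. R\<^sup>2 * (p e)\<^sup>2 * v e"
  shows "(\<Sum>\<Gamma>\<in>Pow E. (P \<Gamma> - (\<Prod>e\<in>\<Gamma>. p e))\<^sup>2 * (\<Prod>e\<in>\<Gamma>. v e))
    \<le> (\<delta>\<^sup>2 + (\<Sum>(e, f)\<in>T. q e * q f)) * exp (\<Sum>e\<in>E. q e)"
proof -
  have q: "0 \<le> q e" if "e \<in> E" for e using v[OF that] by (simp add: q_def)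
  have finT: "finite T" using T(1) fin finite_subset by blast
  have prod_q: "(R ^ card \<Gamma> * (\<Prod>e\<in>\<Gamma>. p e))\<^sup>2 * (\<Prod>e\<in>\<Gamma>. v e) = (\<Prod>e\<in>\<Gamma>. q e)" for \<Gamma>
    by (simp add: q_def prod.distrib power_mult_distrib prod_power_distrib[symmetric] power_commutes
      power_mult[symmetric] mult.commute[of 2])
  let ?A = "\<lambda>(e, f). {\<Gamma>. \<Gamma> \<subseteq> E \<and> e \<in> \<Gamma> \<and> f \<in> \<Gamma>}"
  have summand: "(P \<Gamma> - (\<Prod>e\<in>\<Gamma>. p e))\<^sup>2 * (\<Prod>e\<in>\<Gamma>. v e)
      \<le> \<delta>\<^sup>2 * (\<Prod>e\<in>\<Gamma>. q e) + (\<Sum>t\<in>T. if \<Gamma> \<in> ?A t then (\<Prod>e\<in>\<Gamma>. q e) else 0)" if "\<Gamma> \<in> Pow E" for \<Gamma>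
  proof -
    have \<Gamma>: "\<Gamma> \<subseteq> E" using that by simp
    have vpos: "0 \<le> (\<Prod>e\<in>\<Gamma>. v e)" using v \<Gamma> by (intro prod_nonneg) auto
    have qpos: "0 \<le> (\<Prod>e\<in>\<Gamma>. q e)" using q \<Gamma> by (intro prod_nonneg) auto
    have ppos: "0 \<le> (\<Prod>e\<in>\<Gamma>. p e)" using p \<Gamma> by (intro prod_nonneg) auto
    show ?thesis
    proof (cases "\<exists>e f. (e, f) \<in> T \<and> e \<in> \<Gamma> \<and> f \<in> \<Gamma>")
      case False
      have "(P \<Gamma> - (\<Prod>e\<in>\<Gamma>. p e))\<^sup>2 \<le> (\<delta> * (R ^ card \<Gamma> * (\<Prod>e\<in>\<Gamma>. p e)))\<^sup>2"
        using close[OF \<Gamma>] False by (intro abs_le_square_iff[THEN iffD1]) (metis abs_ge_self order_trans)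
      then have "(P \<Gamma> - (\<Prod>e\<in>\<Gamma>. p e))\<^sup>2 * (\<Prod>e\<in>\<Gamma>. v e) \<le> \<delta>\<^sup>2 * (\<Prod>e\<in>\<Gamma>. q e)"
        unfolding prod_q[symmetric] mult.assoc[symmetric] power_mult_distrib[of \<delta>, symmetric]
        using vpos by (rule mult_right_mono)
      moreover have "0 \<le> (\<Sum>t\<in>T. if \<Gamma> \<in> ?A t then (\<Prod>e\<in>\<Gamma>. q e) else 0)"
        using qpos by (intro sum_nonneg) auto
      ultimately show ?thesis by linarith
    next
      case True
      then obtain e f where ef: "(e, f) \<in> T" "e \<in> \<Gamma>" "f \<in> \<Gamma>" by blast
      \<comment> \<open>Both numbers lie between 0 and this bound, hence so does their distance. For
        the product of \<open>p\<close> this is where \<open>1 \<le> R\<close> enters.\<close>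
      have "P \<Gamma> \<le> R ^ card \<Gamma> * (\<Prod>e\<in>\<Gamma>. p e)" "(\<Prod>e\<in>\<Gamma>. p e) \<le> R ^ card \<Gamma> * (\<Prod>e\<in>\<Gamma>. p e)"
        using bound(2)[OF \<Gamma> ef] mult_right_mono[OF one_le_power[OF R] ppos, of "card \<Gamma>"] by auto
      then have "\<bar>P \<Gamma> - (\<Prod>e\<in>\<Gamma>. p e)\<bar> \<le> R ^ card \<Gamma> * (\<Prod>e\<in>\<Gamma>. p e)"
        using bound(1)[OF \<Gamma>] ppos by linarith
      then have "(P \<Gamma> - (\<Prod>e\<in>\<Gamma>. p e))\<^sup>2 \<le> (R ^ card \<Gamma> * (\<Prod>e\<in>\<Gamma>. p e))\<^sup>2"
        by (intro abs_le_square_iff[THEN iffD1]) linarith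
      then have "(P \<Gamma> - (\<Prod>e\<in>\<Gamma>. p e))\<^sup>2 * (\<Prod>e\<in>\<Gamma>. v e) \<le> (\<Prod>e\<in>\<Gamma>. q e)"
        unfolding prod_q[symmetric] using vpos by (rule mult_right_mono)
      also have "\<dots> \<le> (\<Sum>t\<in>T. if \<Gamma> \<in> ?A t then (\<Prod>e\<in>\<Gamma>. q e) else 0)"
        using member_le_sum[of "(e, f)" T "\<lambda>t. if \<Gamma> \<in> ?A t then (\<Prod>e\<in>\<Gamma>. q e) else 0"] ef \<Gamma> qpos finT
        by auto
      finally show ?thesis using qpos by (simp add: add_increasing)
    qed
  qed
  have "(\<Sum>\<Gamma>\<in>Pow E. (P \<Gamma> - (\<Prod>e\<in>\<Gamma>. p e))\<^sup>2 * (\<Prod>e\<in>\<Gamma>. v e))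
      \<le> \<delta>\<^sup>2 * (\<Sum>\<Gamma>\<in>Pow E. \<Prod>e\<in>\<Gamma>. q e) + (\<Sum>t\<in>T. \<Sum>\<Gamma>\<in>Pow E. if \<Gamma> \<in> ?A t then (\<Prod>e\<in>\<Gamma>. q e) else 0)"
    using sum_mono[OF summand, of "Pow E"] unfolding sum.distrib sum_distrib_left
    by (subst sum.swap[of _ "Pow E" T]) simp
  also have "(\<Sum>t\<in>T. \<Sum>\<Gamma>\<in>Pow E. if \<Gamma> \<in> ?A t then (\<Prod>e\<in>\<Gamma>. q e) else 0)
      \<le> (\<Sum>(e, f)\<in>T. q e * q f * exp (\<Sum>e\<in>E. q e))"
  proof (rule sum_mono)
    fix t assume t: "t \<in> T"
    obtain e f where ef: "t = (e, f)" by (cases t)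
    have "(\<Sum>\<Gamma>\<in>Pow E. if \<Gamma> \<in> ?A t then (\<Prod>e\<in>\<Gamma>. q e) else 0) = (\<Sum>\<Gamma>\<in>?A t. \<Prod>e\<in>\<Gamma>. q e)"
      using fin by (subst sum.inter_restrict[symmetric]) (auto simp: ef intro!: sum.cong)
    also have "\<dots> \<le> q e * q f * exp (\<Sum>e\<in>E. q e)"
      using sum_Pow_prod_pair_le[where q = q and e = e and f = f, OF fin q] t T ef by auto
    finally show "(\<Sum>\<Gamma>\<in>Pow E. if \<Gamma> \<in> ?A t then (\<Prod>e\<in>\<Gamma>. q e) else 0) \<le> (case t of (e, f) \<Rightarrow> q e * q f * exp (\<Sum>e\<in>E. q e))"
      by (simp add: ef)
  qed
  also have "\<delta>\<^sup>2 * (\<Sum>\<Gamma>\<in>Pow E. \<Prod>e\<in>\<Gamma>. q e) \<le> \<delta>\<^sup>2 * exp (\<Sum>e\<in>E. q e)"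
    using sum_Pow_prod_le_exp[where q = q, OF fin q] by (intro mult_left_mono) auto
  finally show ?thesis
    by (simp add: distrib_right sum_distrib_right case_prod_unfold)
qed

section \<open>Characteristic functions of triangular arrays\<close>

text \<open>Expanding by \<open>iexp_ln_expansion\<close>, the linear term drops out since
  \<open>X\<close> has mean 0, and what remains is \<open>p^2\<close> times the expectation of
  \<open>X^2 * log_remainder t (p * X)\<close>. Dominated convergence replaces the remainder by its
  value at 0: \<open>X \<ge> -1\<close> and \<open>p \<le> 1/2\<close> give
  \<open>p * X \<ge> -1/2\<close>, as \<open>norm_log_remainder_le\<close> requires.\<close>

lemma log_affine_char_tendsto:
  fixes X :: "'x \<Rightarrow> real" and p N :: "nat \<Rightarrow> real"
  assumes "prob_space Q"
    and X [measurable]: "X \<in> borel_measurable Q" and X_ge: "\<And>x. - 1 \<le> X x"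
    and sq: "integrable Q (\<lambda>x. (X x)\<^sup>2)" and mean: "(\<integral>x. X x \<partial>Q) = 0"
    and p: "\<And>n. 0 \<le> p n" "p \<longlonglongrightarrow> 0" and N: "(\<lambda>n. N n * (p n)\<^sup>2) \<longlonglongrightarrow> g"
  shows "(\<lambda>n. of_real (N n) * ((CLINT x|Q. iexp (t * ln (1 + p n * X x))) - 1))
    \<longlonglongrightarrow> of_real (g * (\<integral>x. (X x)\<^sup>2 \<partial>Q)) * log_remainder t 0"
proof -
  interpret Q: prob_space Q by fact
  let ?h = "\<lambda>n x. of_real ((X x)\<^sup>2) * log_remainder t (p n * X x)"
  let ?C = "2 * t\<^sup>2 + 2 * \<bar>t\<bar>"
  have int: "integrable Q X" using Q.square_integrable_imp_integrable[OF X sq] .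
  have small: "eventually (\<lambda>n. p n \<le> 1 / 2) sequentially"
    using order_tendstoD(2)[OF p(2), of "1/2"] by (auto elim: eventually_mono)
  have bound: "norm (of_real ((X x)\<^sup>2) * log_remainder t (c * X x)) \<le> (X x)\<^sup>2 * ?C"
    if "0 \<le> c" "c \<le> 1 / 2" for c x
  proof -
    have "c * (- 1) \<le> c * X x" using X_ge that by (intro mult_left_mono) auto
    then have "- 1 / 2 \<le> c * X x" using that by simp
    then show ?thesis
      unfolding norm_mult by (simp add: norm_log_remainder_le mult_left_mono del: of_real_power)
  qed
  have lim_h: "(\<lambda>n. \<integral>x. ?h n x \<partial>Q) \<longlonglongrightarrow> (\<integral>x. of_real ((X x)\<^sup>2) * log_remainder t 0 \<partial>Q)"
  proof -
    \<comment> \<open>Dominated convergence asks for the bound at every \<open>n\<close>; the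
      finitely many \<open>p n\<close> above \<open>1/2\<close> are therefore replaced by 0.\<close>
    define k where "k n = (if p n \<le> 1 / 2 then p n else 0)" for n
    have k_eq: "eventually (\<lambda>n. k n = p n) sequentially"
      using small by eventually_elim (simp add: k_def)
    have k_le: "k n \<le> 1 / 2" "0 \<le> k n" for n using p by (auto simp: k_def)
    have k0: "k \<longlonglongrightarrow> 0"
      using tendsto_cong[OF k_eq] p(2) by blast
    have "(\<lambda>n. \<integral>x. of_real ((X x)\<^sup>2) * log_remainder t (k n * X x) \<partial>Q)
        \<longlonglongrightarrow> (\<integral>x. of_real ((X x)\<^sup>2) * log_remainder t 0 \<partial>Q)"
    proof (rule integral_dominated_convergence)
      show "integrable Q (\<lambda>x. (X x)\<^sup>2 * ?C)" using sq by simp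
      show "AE x in Q. (\<lambda>n. of_real ((X x)\<^sup>2) * log_remainder t (k n * X x))
          \<longlonglongrightarrow> of_real ((X x)\<^sup>2) * log_remainder t 0"
      proof (intro AE_I2 tendsto_mult_left)
        fix x
        have "(\<lambda>n. k n * X x) \<longlonglongrightarrow> 0" using tendsto_mult_left_zero[OF k0] .
        then show "(\<lambda>n. log_remainder t (k n * X x)) \<longlonglongrightarrow> log_remainder t 0"
          by (rule isCont_tendsto_compose[OF isCont_log_remainder])
      qed
      fix n show "AE x in Q. norm (of_real ((X x)\<^sup>2) * log_remainder t (k n * X x)) \<le> (X x)\<^sup>2 * ?C"
        by (intro AE_I2 bound k_le)
    qed measurable
    moreover have "eventually (\<lambda>n. (\<integral>x. of_real ((X x)\<^sup>2) * log_remainder t (k n * X x) \<partial>Q) = (\<integral>x. ?h n x \<partial>Q)) sequentially"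
      using k_eq by eventually_elim simp
    ultimately show ?thesis by (rule Lim_transform_eventually)
  qed
  have expand: "eventually (\<lambda>n. of_real (N n * (p n)\<^sup>2) * (\<integral>x. ?h n x \<partial>Q)
      = of_real (N n) * ((CLINT x|Q. iexp (t * ln (1 + p n * X x))) - 1)) sequentially"
    using small
  proof eventually_elim
    case (elim n)
    have h_int: "integrable Q (?h n)"
    proof (rule Bochner_Integration.integrable_bound)
      show "integrable Q (\<lambda>x. (X x)\<^sup>2 * ?C)" using sq by simp
      show "AE x in Q. norm (?h n x) \<le> norm ((X x)\<^sup>2 * ?C)"
        unfolding real_norm_def by (intro AE_I2 order_trans[OF bound[OF p(1) elim] abs_ge_self])
    qed measurable
    have "iexp (t * ln (1 + p n * X x)) = 1 + \<i> * of_real (t * p n) * of_real (X x) + of_real ((p n)\<^sup>2) * ?h n x" for x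
      unfolding iexp_ln_expansion by (simp add: power_mult_distrib mult_ac)
    then have "(CLINT x|Q. iexp (t * ln (1 + p n * X x)))
      = (CLINT x|Q. 1 + \<i> * of_real (t * p n) * of_real (X x) + of_real ((p n)\<^sup>2) * ?h n x)"
      by (simp only:)
    also have "\<dots> = 1 + \<i> * of_real (t * p n) * of_real (\<integral>x. X x \<partial>Q) + of_real ((p n)\<^sup>2) * (\<integral>x. ?h n x \<partial>Q)"
      using int h_int by (simp add: Q.prob_space del: of_real_power of_real_mult)
    finally show ?case by (simp add: mean)
  qed
  have "(\<lambda>n. of_real (N n * (p n)\<^sup>2) * (\<integral>x. ?h n x \<partial>Q)) \<longlonglongrightarrow> of_real g * (\<integral>x. of_real ((X x)\<^sup>2) * log_remainder t 0 \<partial>Q)"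
    by (intro tendsto_mult tendsto_of_real N lim_h)
  also have "of_real g * (\<integral>x. of_real ((X x)\<^sup>2) * log_remainder t 0 \<partial>Q)
      = of_real (g * (\<integral>x. (X x)\<^sup>2 \<partial>Q)) * log_remainder t 0"
    by (simp del: of_real_power)
  finally show ?thesis using expand by (rule Lim_transform_eventually)
qed

text \<open>Each factor \<open>1 + a\<close> is replaced by \<open>exp a\<close> at a cost of order
  \<open>\<bar>a\<bar>^2\<close>. As all factors have norm at most 1, the difference of the two
  products is at most the sum of these costs.\<close>

lemma prod_one_plus_tendsto_exp:
  fixes a :: "nat \<Rightarrow> 'e \<Rightarrow> complex"
  assumes fin: "\<And>n. finite (E n)"
    and norm: "\<And>n e. e \<in> E n \<Longrightarrow> norm (1 + a n e) \<le> 1"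
    and lim: "(\<lambda>n. \<Sum>e\<in>E n. a n e) \<longlonglongrightarrow> A"
    and sq: "(\<lambda>n. \<Sum>e\<in>E n. (norm (a n e))\<^sup>2) \<longlonglongrightarrow> 0"
  shows "(\<lambda>n. \<Prod>e\<in>E n. 1 + a n e) \<longlonglongrightarrow> exp A"
proof -
  have bound: "norm ((\<Prod>e\<in>E n. 1 + a n e) - exp (\<Sum>e\<in>E n. a n e)) \<le> exp 2 * (\<Sum>e\<in>E n. (norm (a n e))\<^sup>2)" for n
  proof -
    have le: "norm (1 + a n e - exp (a n e)) \<le> exp 2 * (norm (a n e))\<^sup>2" "norm (exp (a n e)) \<le> 1" if "e \<in> E n" for e
    proof -
      \<comment> \<open>This gives \<open>\<bar>a\<bar> \<le> 2\<close>, the source of the constant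
        \<open>exp 2\<close> in the Taylor bound.\<close>
      have "norm (a n e) \<le> norm (1 + a n e) + norm (1::complex)"
        using norm_triangle_ineq4[of "1 + a n e" 1] by simp
      then have "norm (a n e) \<le> 2" using norm[OF that] by simp
      then have Re: "\<bar>Re (a n e)\<bar> \<le> 2" using abs_Re_le_cmod order_trans by blast
      have "norm (exp (a n e) - (1 + a n e)) \<le> exp \<bar>Re (a n e)\<bar> * (norm (a n e))\<^sup>2"
        using Taylor_exp[of "a n e" 1] by (simp add: numeral_2_eq_2)
      also have "\<dots> \<le> exp 2 * (norm (a n e))\<^sup>2"
        using Re by (intro mult_right_mono) auto
      finally show "norm (1 + a n e - exp (a n e)) \<le> exp 2 * (norm (a n e))\<^sup>2"
        by (simp add: norm_minus_commute)
      \<comment> \<open>So \<open>Re a \<le> 0\<close>, and \<open>exp a\<close> has norm at most 1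
        as well.\<close>
      have "Re (1 + a n e) \<le> 1" using norm[OF that] complex_Re_le_cmod order_trans by blast
      then show "norm (exp (a n e)) \<le> 1" by simp
    qed
    have "norm ((\<Prod>e\<in>E n. 1 + a n e) - (\<Prod>e\<in>E n. exp (a n e))) \<le> (\<Sum>e\<in>E n. norm (1 + a n e - exp (a n e)))"
      using norm le by (intro norm_prod_diff) auto
    also have "\<dots> \<le> exp 2 * (\<Sum>e\<in>E n. (norm (a n e))\<^sup>2)"
      unfolding sum_distrib_left using le by (intro sum_mono) auto
    finally show ?thesis by (simp add: exp_sum[OF fin])
  qed
  have "(\<lambda>n. exp 2 * (\<Sum>e\<in>E n. (norm (a n e))\<^sup>2)) \<longlonglongrightarrow> 0"
    using tendsto_mult_right_zero[OF sq] .
  then have "(\<lambda>n. (\<Prod>e\<in>E n. 1 + a n e) - exp (\<Sum>e\<in>E n. a n e)) \<longlonglongrightarrow> 0"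
    by (rule Lim_null_comparison[rotated]) (simp add: bound)
  from tendsto_add[OF this tendsto_exp[OF lim]] show ?thesis by simp
qed

section \<open>The block graph and the tilted weights\<close>

lemma finite_block_pairs [simp]: "finite (block_pairs L)"
  by (rule finite_subset[of _ "{1..L} \<times> {1..L}"]) (auto simp: block_pairs_def)

context block_graphs
begin

abbreviation pair_edges :: "nat \<Rightarrow> nat \<times> nat \<Rightarrow> 'v set set" where
  "pair_edges n k \<equiv> edges_between (B n (fst k)) (B n (snd k))"

definition edge_pair :: "nat \<Rightarrow> 'v set \<Rightarrow> nat \<times> nat" where
  "edge_pair n e = (THE k. k \<in> block_pairs L \<and> e \<in> pair_edges n k)"

lemma block_edges_eq: "block_edges L B n = (\<Union>k\<in>block_pairs L. pair_edges n k)"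
  by (simp add: block_edges_def case_prod_unfold)

lemma block_subset: "i \<in> {1..L} \<Longrightarrow> B n i \<subseteq> V n"
  using blocks_cover by blast

lemma finite_block: "i \<in> {1..L} \<Longrightarrow> finite (B n i)"
  using block_subset finite_V finite_subset by blast

lemma block_index_unique:
  "u \<in> B n i \<Longrightarrow> u \<in> B n j \<Longrightarrow> i \<in> {1..L} \<Longrightarrow> j \<in> {1..L} \<Longrightarrow> i = j"
  using blocks_disjoint[of n] unfolding disjoint_family_on_def by blast

lemma block_pair_unique:
  assumes "k \<in> block_pairs L" "k' \<in> block_pairs L" "e \<in> pair_edges n k" "e \<in> pair_edges n k'"
  shows "k = k'"
proof -
  obtain u w where 1: "e = {u, w}" "u \<in> B n (fst k)" "w \<in> B n (snd k)"
    using assms(3) by (auto simp: edges_between_def)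
  obtain x y where 2: "e = {x, y}" "x \<in> B n (fst k')" "y \<in> B n (snd k')"
    using assms(4) by (auto simp: edges_between_def)
  have idx: "fst k \<in> {1..L}" "snd k \<in> {1..L}" "fst k \<le> snd k" "fst k' \<in> {1..L}" "snd k' \<in> {1..L}" "fst k' \<le> snd k'"
    using assms(1,2) by (auto simp: block_pairs_def)
  consider "u = x" "w = y" | "u = y" "w = x"
    using 1 2 by (auto simp: doubleton_eq_iff)
  then show ?thesis
  proof cases
    case 1
    then have "fst k = fst k'" "snd k = snd k'"
      using block_index_unique idx \<open>u \<in> B n (fst k)\<close> \<open>w \<in> B n (snd k)\<close> 2 by blast+
    then show ?thesis by (simp add: prod_eq_iff)
  next
    \<comment> \<open>The endpoints match crosswise. Since both index pairs are ordered, equality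
      after a swap forces all four indices to agree.\<close>
    case 2
    then have "fst k = snd k'" "snd k = fst k'"
      using block_index_unique idx 1 \<open>x \<in> B n (fst k')\<close> \<open>y \<in> B n (snd k')\<close> by blast+
    then show ?thesis using idx by (simp add: prod_eq_iff)
  qed
qed

lemma edge_pair_eq: "k \<in> block_pairs L \<Longrightarrow> e \<in> pair_edges n k \<Longrightarrow> edge_pair n e = k"
  unfolding edge_pair_def using block_pair_unique by (intro the_equality) blast+

lemma edge_pair:
  assumes "e \<in> block_edges L B n"
  shows "edge_pair n e \<in> block_pairs L" "e \<in> pair_edges n (edge_pair n e)"
  using assms edge_pair_eq by (auto simp: block_edges_eq)

lemma pair_edges_subset: "k \<in> block_pairs L \<Longrightarrow> pair_edges n k \<subseteq> (\<lambda>(u, w). {u, w}) ` (V n \<times> V n)"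
  using block_subset[of "fst k" n] block_subset[of "snd k" n]
  by (force simp: edges_between_def block_pairs_def)

lemma block_edges_subset: "block_edges L B n \<subseteq> (\<lambda>(u, w). {u, w}) ` (V n \<times> V n)"
  unfolding block_edges_eq using pair_edges_subset by blast

lemma finite_block_edges [simp]: "finite (block_edges L B n)"
  using finite_subset[OF block_edges_subset] finite_V by blast

lemma finite_pair_edges: "k \<in> block_pairs L \<Longrightarrow> finite (pair_edges n k)"
  using finite_subset[OF pair_edges_subset] finite_V by blast

text \<open>Groups edges by type. The index set \<open>block_pairs L\<close> does not depend on
  \<open>n\<close>, so limits of sums over edges can then be taken term by term.\<close>

lemma sum_edge_pair:
  fixes f :: "nat \<times> nat \<Rightarrow> 'c::semiring_1"
  assumes "A \<subseteq> block_edges L B n"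
  shows "(\<Sum>e\<in>A. f (edge_pair n e)) = (\<Sum>k\<in>block_pairs L. of_nat (card (A \<inter> pair_edges n k)) * f k)"
proof -
  have "(\<Sum>e\<in>A. f (edge_pair n e)) = (\<Sum>e\<in>(\<Union>k\<in>block_pairs L. A \<inter> pair_edges n k). f (edge_pair n e))"
    using assms by (intro sum.cong) (auto simp: block_edges_eq)
  also have "\<dots> = (\<Sum>k\<in>block_pairs L. \<Sum>e\<in>A \<inter> pair_edges n k. f (edge_pair n e))"
    using block_pair_unique finite_pair_edges by (intro sum.UNION_disjoint) auto
  also have "\<dots> = (\<Sum>k\<in>block_pairs L. \<Sum>e\<in>A \<inter> pair_edges n k. f k)"
    using edge_pair_eq by (intro sum.cong refl arg_cong[where f = f]) auto
  finally show ?thesis by simp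
qed

lemma sum_block_edges_pair:
  fixes f :: "nat \<times> nat \<Rightarrow> 'c::semiring_1"
  shows "(\<Sum>e\<in>block_edges L B n. f (edge_pair n e)) = (\<Sum>k\<in>block_pairs L. of_nat (card (pair_edges n k)) * f k)"
proof -
  have "block_edges L B n \<inter> pair_edges n k = pair_edges n k" if "k \<in> block_pairs L" for k
    using that by (auto simp: block_edges_eq)
  then show ?thesis by (subst sum_edge_pair) auto
qed

lemma card_pair_edges_asymp:
  assumes k: "k \<in> block_pairs L"
  obtains c where "0 < c" "(\<lambda>n. real (card (pair_edges n k)) / (real n)\<^sup>2) \<longlonglongrightarrow> c"
proof -
  obtain s t where st: "k = (s, t)" "s \<in> {1..L}" "t \<in> {1..L}" "s \<le> t"
    using k by (auto simp: block_pairs_def)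
  let ?r = "\<lambda>i n. real (card (B n i)) / real n"
  show thesis
  proof (cases "s = t")
    case False
    have disj: "B n s \<inter> B n t = {}" for n
      using block_index_unique[of _ n s t] st False by blast
    have "real (card (pair_edges n k)) / (real n)\<^sup>2 = ?r s n * ?r t n" for n
      using st finite_block disj by (simp add: card_edges_between_disjoint power2_eq_square)
    moreover have "(\<lambda>n. ?r s n * ?r t n) \<longlonglongrightarrow> lam s * lam t"
      using st by (intro tendsto_mult block_proportions)
    ultimately show thesis using that[of "lam s * lam t"] lam_pos st by simp
  next
    case True
    \<comment> \<open>The product is even, so the division is exact; at \<open>a = 0\<close> the
      truncated \<open>a - 1\<close> is multiplied by 0.\<close>
    have half: "real (a * (a - 1) div 2) = real a * (real a - 1) / 2" for a :: nat
      by (cases a) (simp_all add: real_of_nat_div algebra_simps)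
    have "real (card (pair_edges n k)) / (real n)\<^sup>2 = ?r s n * (?r s n - 1 / real n) / 2" for n
    proof -
      have "real (card (pair_edges n k)) = real (card (B n s)) * (real (card (B n s)) - 1) / 2"
        using st True finite_block half[of "card (B n s)"] by (simp add: card_edges_between_same)
      then show ?thesis by (simp add: power2_eq_square diff_divide_distrib right_diff_distrib)
    qed
    moreover have "(\<lambda>n. ?r s n * (?r s n - 1 / real n) / 2) \<longlonglongrightarrow> lam s * (lam s - 0) / 2"
      using st by (intro tendsto_intros block_proportions lim_1_over_n) auto
    ultimately show thesis using that[of "lam s * lam s / 2"] lam_pos st by simp
  qed
qed

lemma card_pair_edges_at_top:
  assumes "k \<in> block_pairs L"
  shows "filterlim (\<lambda>n. real (card (pair_edges n k))) at_top sequentially"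
proof -
  obtain c where c: "0 < c" "(\<lambda>n. real (card (pair_edges n k)) / (real n)\<^sup>2) \<longlonglongrightarrow> c"
    using card_pair_edges_asymp[OF assms] by blast
  have "filterlim (\<lambda>n. (real n)\<^sup>2) at_top sequentially"
    by (intro filterlim_pow_at_top filterlim_real_sequentially) auto
  from filterlim_tendsto_pos_mult_at_top[OF c(2,1) this]
  have "filterlim (\<lambda>n. real (card (pair_edges n k)) / (real n)\<^sup>2 * (real n)\<^sup>2) at_top sequentially" .
  moreover have "eventually (\<lambda>n. real (card (pair_edges n k)) / (real n)\<^sup>2 * (real n)\<^sup>2 = real (card (pair_edges n k))) sequentially"
    using eventually_gt_at_top[of 0] by eventually_elim simp
  ultimately show ?thesis by (rule filterlim_cong[OF refl refl, THEN iffD1, rotated])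
qed

text \<open>The obstructions to being a matching, as ordered pairs; they play the part of
  \<open>T\<close> in \<open>sum_Pow_squared_difference_le\<close>.\<close>

definition adjacent_pairs :: "nat \<Rightarrow> ('v set \<times> 'v set) set" where
  "adjacent_pairs n = {(e, f). e \<in> block_edges L B n \<and> f \<in> block_edges L B n \<and> e \<noteq> f \<and> e \<inter> f \<noteq> {}}"

lemma partial_matching_iff:
  assumes "\<Gamma> \<subseteq> block_edges L B n"
  shows "partial_matching \<Gamma> \<longleftrightarrow> (\<forall>(e, f)\<in>adjacent_pairs n. \<not> (e \<in> \<Gamma> \<and> f \<in> \<Gamma>))"
  using assms unfolding partial_matching_def adjacent_pairs_def by blast

text \<open>There are at most \<open>n^2\<close> edges. An edge meeting \<open>e\<close> is
  determined by a vertex of \<open>e\<close>, of which there are two, and a second vertex among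
  \<open>n\<close>.\<close>

lemma card_adjacent_pairs_le: "card (adjacent_pairs n) \<le> 2 * n ^ 3"
proof -
  let ?E = "block_edges L B n"
  have card_E: "card ?E \<le> n ^ 2"
  proof -
    have "card ?E \<le> card (V n \<times> V n)"
      using finite_V by (intro surj_card_le[OF _ block_edges_subset]) auto
    then show ?thesis by (simp add: card_V card_cartesian_product power2_eq_square)
  qed
  have nbr: "card {f \<in> ?E. e \<inter> f \<noteq> {}} \<le> 2 * n" if "e \<in> ?E" for e
  proof -
    have "e \<in> (\<lambda>(u, w). {u, w}) ` (V n \<times> V n)" using that block_edges_subset by (rule set_mp[rotated])
    then obtain u w where e: "e = {u, w}" by auto
    have "{f \<in> ?E. e \<inter> f \<noteq> {}} \<subseteq> (\<lambda>(x, y). {x, y}) ` (e \<times> V n)"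
    proof
      fix f assume f: "f \<in> {f \<in> ?E. e \<inter> f \<noteq> {}}"
      then have "f \<in> (\<lambda>(u, w). {u, w}) ` (V n \<times> V n)" using block_edges_subset[of n] by blast
      then obtain x y where xy: "f = {x, y}" "x \<in> V n" "y \<in> V n" by auto
      then consider "x \<in> e" | "y \<in> e" using f by auto
      then show "f \<in> (\<lambda>(x, y). {x, y}) ` (e \<times> V n)"
      proof cases
        case 1
        then show ?thesis using xy by (intro image_eqI[of _ _ "(x, y)"]) auto
      next
        case 2
        then show ?thesis using xy by (intro image_eqI[of _ _ "(y, x)"]) auto
      qed
    qed
    then have "card {f \<in> ?E. e \<inter> f \<noteq> {}} \<le> card (e \<times> V n)"
      using finite_V e by (intro surj_card_le[where f = "\<lambda>(x, y). {x, y}"]) auto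
    also have "\<dots> \<le> 2 * n"
      using e by (simp add: card_cartesian_product card_V card_insert_if)
    finally show ?thesis .
  qed
  have "adjacent_pairs n \<subseteq> (SIGMA e:?E. {f \<in> ?E. e \<inter> f \<noteq> {}})"
    by (auto simp: adjacent_pairs_def)
  then have "card (adjacent_pairs n) \<le> card (SIGMA e:?E. {f \<in> ?E. e \<inter> f \<noteq> {}})"
    by (intro card_mono finite_SigmaI) auto
  also have "\<dots> = (\<Sum>e\<in>?E. card {f \<in> ?E. e \<inter> f \<noteq> {}})"
    by (intro card_SigmaI) auto
  also have "\<dots> \<le> (\<Sum>e\<in>?E. 2 * n)"
    using nbr by (intro sum_mono) auto
  also have "\<dots> \<le> 2 * n ^ 3"
    using card_E mult_right_mono[OF card_E, of "2 * n"] by (simp add: power2_eq_square power3_eq_cube)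
  finally show ?thesis .
qed

end

section \<open>Boltzmann factors and their centred normalization\<close>

lemma boltzmann_nonneg: "0 \<le> boltzmann \<beta> x"
  by (simp add: boltzmann_def)

lemma boltzmann_eq_0_iff: "boltzmann \<beta> x = 0 \<longleftrightarrow> x = \<infinity>"
  by (simp add: boltzmann_def)

lemma boltzmann_power2: "(boltzmann \<beta> x)\<^sup>2 = boltzmann (2 * \<beta>) x"
  by (simp add: boltzmann_def exp_double[symmetric] mult.assoc)

lemma borel_measurable_boltzmann [measurable]: "boltzmann \<beta> \<in> borel_measurable borel"
  unfolding boltzmann_def by measurable

text \<open>A summand \<open>\<infinity>\<close> makes both sides 0, so one infinite weight
  annihilates the factor of the whole subgraph.\<close>

lemma boltzmann_add:
  assumes "x \<noteq> -\<infinity>" "y \<noteq> -\<infinity>"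
  shows "boltzmann \<beta> (x + y) = boltzmann \<beta> x * boltzmann \<beta> y"
  using assms by (cases x; cases y) (auto simp: boltzmann_def exp_add[symmetric] algebra_simps)

lemma boltzmann_sum:
  assumes "\<And>e. e \<in> A \<Longrightarrow> w e \<noteq> -\<infinity>"
  shows "boltzmann \<beta> (\<Sum>e\<in>A. w e) = (\<Prod>e\<in>A. boltzmann \<beta> (w e))"
  using assms
proof (induction A rule: infinite_finite_induct)
  case (insert e A)
  have "(\<Sum>e\<in>A. w e) \<noteq> -\<infinity>"
    using \<open>finite A\<close> insert.prems by (induction A) auto
  then show ?case using insert by (simp add: boltzmann_add)
qed (simp_all add: boltzmann_def)

text \<open>The centred edge variable: \<open>exp (psi Q \<beta>)\<close> is the mean of the
  Boltzmann factor. The lower bound -1 is attained at infinite weight.\<close>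

definition tilted_weight :: "ereal measure \<Rightarrow> real \<Rightarrow> ereal \<Rightarrow> real" where
  "tilted_weight Q \<beta> x = boltzmann \<beta> x / exp (psi Q \<beta>) - 1"

lemma tilted_weight_ge: "- 1 \<le> tilted_weight Q \<beta> x"
  using boltzmann_nonneg[of \<beta> x] by (simp add: tilted_weight_def)

lemma borel_measurable_tilted_weight [measurable]: "tilted_weight Q \<beta> \<in> borel_measurable borel"
  unfolding tilted_weight_def by measurable

context
  fixes Q :: "ereal measure" and \<beta> :: real
  assumes Q: "prob_space Q" "\<not> (AE x in Q. x = \<infinity>)"
    and int: "\<And>\<beta>. 0 \<le> \<beta> \<Longrightarrow> integrable Q (boltzmann \<beta>)" and \<beta>: "0 \<le> \<beta>"
begin

text \<open>The logarithm in \<open>psi\<close> is genuine: a nonnegative variable with mean 0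
  vanishes almost surely, which would make the weight almost surely infinite.\<close>

lemma exp_psi: "0 \<le> b \<Longrightarrow> exp (psi Q b) = (\<integral>x. boltzmann b x \<partial>Q)"
proof -
  assume b: "0 \<le> b"
  have "(\<integral>x. boltzmann b x \<partial>Q) \<noteq> 0"
    using integral_nonneg_eq_0_iff_AE[OF int[OF b]] Q(2) by (simp add: boltzmann_nonneg boltzmann_eq_0_iff)
  moreover have "0 \<le> (\<integral>x. boltzmann b x \<partial>Q)"
    by (simp add: boltzmann_nonneg integral_nonneg_AE)
  ultimately show ?thesis by (simp add: psi_def)
qed

lemma tilted_weight_moments:
  shows "(\<integral>x. tilted_weight Q \<beta> x \<partial>Q) = 0"
    and "integrable Q (\<lambda>x. (tilted_weight Q \<beta> x)\<^sup>2)"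
    and "(\<integral>x. (tilted_weight Q \<beta> x)\<^sup>2 \<partial>Q) = v2 Q \<beta>"
proof -
  interpret prob_space Q by (rule Q)
  let ?e = "exp (psi Q \<beta>)"
  have e: "?e = (\<integral>x. boltzmann \<beta> x \<partial>Q)" using exp_psi[OF \<beta>] .
  show "(\<integral>x. tilted_weight Q \<beta> x \<partial>Q) = 0"
    unfolding tilted_weight_def using int[OF \<beta>] by (simp add: prob_space e[symmetric])
  \<comment> \<open>Squaring a Boltzmann factor doubles the inverse temperature; this brings
    \<open>psi Q (2 * \<beta>)\<close> into the variance.\<close>
  have sq: "(tilted_weight Q \<beta> x)\<^sup>2 = boltzmann (2 * \<beta>) x / ?e\<^sup>2 - 2 * (boltzmann \<beta> x / ?e) + 1" for x
    unfolding tilted_weight_def boltzmann_power2[symmetric] by (simp add: power2_diff power_divide)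
  have int2: "integrable Q (boltzmann (2 * \<beta>))" using int \<beta> by simp
  show "integrable Q (\<lambda>x. (tilted_weight Q \<beta> x)\<^sup>2)"
    unfolding sq using int[OF \<beta>] int2 by simp
  have "(\<integral>x. (tilted_weight Q \<beta> x)\<^sup>2 \<partial>Q) = exp (psi Q (2 * \<beta>)) / ?e\<^sup>2 - 1"
    unfolding sq using int[OF \<beta>] int2 exp_psi[of "2 * \<beta>"] \<beta> by (simp add: prob_space e[symmetric])
  then show "(\<integral>x. (tilted_weight Q \<beta> x)\<^sup>2 \<partial>Q) = v2 Q \<beta>"
    by (simp add: v2_def exp_diff exp_double)
qed

end

section \<open>The normalized partition function\<close>

context block_optimization
begin

definition edge_density :: "nat \<Rightarrow> nat \<times> nat \<Rightarrow> real" where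
  "edge_density n k = real (m n (fst k) (snd k)) / real (card (pair_edges n k))"

lemma edge_density_nonneg: "0 \<le> edge_density n k"
  by (simp add: edge_density_def)

lemma card_mult_edge_density_sq_tendsto:
  assumes "k \<in> block_pairs L"
  shows "(\<lambda>n. real (card (pair_edges n k)) * (edge_density n k)\<^sup>2) \<longlonglongrightarrow> 2 * \<gamma> (fst k) (snd k)"
proof -
  have "real (card (pair_edges n k)) * (edge_density n k)\<^sup>2
      = 2 * ((real (m n (fst k) (snd k)))\<^sup>2 / (2 * real (card (pair_edges n k))))" for n
    by (cases "card (pair_edges n k) = 0") (auto simp: edge_density_def power2_eq_square)
  then show ?thesis
    using tendsto_mult_left[OF edge_counts_limit[of "fst k" "snd k"], of 2] assms by simp
qed

lemma edge_density_tendsto_0: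
  assumes "k \<in> block_pairs L"
  shows "(\<lambda>n. edge_density n k) \<longlonglongrightarrow> 0"
proof -
  have "(\<lambda>n. real (card (pair_edges n k)) * (edge_density n k)\<^sup>2 / real (card (pair_edges n k))) \<longlonglongrightarrow> 0"
    by (rule tendsto_divide_0[OF card_mult_edge_density_sq_tendsto[OF assms]
        filterlim_at_top_imp_at_infinity[OF card_pair_edges_at_top[OF assms]]])
  moreover have "real (card (pair_edges n k)) * (edge_density n k)\<^sup>2 / real (card (pair_edges n k)) = (edge_density n k)\<^sup>2" for n
    by (cases "card (pair_edges n k) = 0") (auto simp: edge_density_def)
  ultimately have "(\<lambda>n. (edge_density n k)\<^sup>2) \<longlonglongrightarrow> 0" by simp
  from tendsto_real_sqrt[OF this] show ?thesis by (simp add: edge_density_nonneg)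
qed

text \<open>The edge density is thus of order at most \<open>1 / n\<close>, so a pair of adjacent
  edges will carry weight of order at most \<open>n^-4\<close>.\<close>

lemma square_mult_edge_density_sq_convergent:
  assumes "k \<in> block_pairs L"
  shows "convergent (\<lambda>n. (real n)\<^sup>2 * (edge_density n k)\<^sup>2)"
proof -
  obtain c where c: "0 < c" "(\<lambda>n. real (card (pair_edges n k)) / (real n)\<^sup>2) \<longlonglongrightarrow> c"
    using card_pair_edges_asymp[OF assms] by blast
  have "(\<lambda>n. real (card (pair_edges n k)) * (edge_density n k)\<^sup>2 / (real (card (pair_edges n k)) / (real n)\<^sup>2))
      \<longlonglongrightarrow> 2 * \<gamma> (fst k) (snd k) / c"
    using c by (intro tendsto_divide card_mult_edge_density_sq_tendsto[OF assms]) auto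
  moreover have "real (card (pair_edges n k)) * (edge_density n k)\<^sup>2 / (real (card (pair_edges n k)) / (real n)\<^sup>2)
      = (real n)\<^sup>2 * (edge_density n k)\<^sup>2" for n
    by (cases "card (pair_edges n k) = 0") (auto simp: edge_density_def)
  ultimately show ?thesis by (auto intro: convergentI)
qed

definition total_edges :: "nat \<Rightarrow> nat" where
  "total_edges n = (\<Sum>(s, t)\<in>block_pairs L. m n s t)"

text \<open>One block is enough: \<open>m n 1 1\<close> squared is a quantity with limit
  \<open>\<gamma> 1 1 > 0\<close> times twice the diverging number of edges inside the first
  block.\<close>

lemma inverse_total_edges_tendsto_0: "(\<lambda>n. 1 / real (total_edges n)) \<longlonglongrightarrow> 0"
proof -
  have k: "(1, 1) \<in> block_pairs L" using L_ge_2 by (simp add: block_pairs_def)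
  let ?N = "\<lambda>n. real (card (pair_edges n (1, 1)))"
  have "filterlim (\<lambda>n. (real (m n 1 1))\<^sup>2 / (2 * ?N n) * (2 * ?N n)) at_top sequentially"
  proof (rule filterlim_tendsto_pos_mult_at_top)
    show "(\<lambda>n. (real (m n 1 1))\<^sup>2 / (2 * ?N n)) \<longlonglongrightarrow> \<gamma> 1 1"
      using edge_counts_limit[OF k] by simp
    show "0 < \<gamma> 1 1" using gamma_pos[OF k] .
    show "filterlim (\<lambda>n. 2 * ?N n) at_top sequentially"
      by (rule filterlim_tendsto_pos_mult_at_top[OF tendsto_const _ card_pair_edges_at_top[OF k]]) simp
  qed
  then have "filterlim (\<lambda>n. sqrt ((real (m n 1 1))\<^sup>2 / (2 * ?N n) * (2 * ?N n))) at_top sequentially"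
    by (rule filterlim_compose[OF sqrt_at_top])
  then have "filterlim (\<lambda>n. real (total_edges n)) at_top sequentially"
  proof (rule filterlim_at_top_mono, intro always_eventually allI)
    fix n
    \<comment> \<open>Only an inequality: if the block has no edges, the quotient is 0 by
      convention.\<close>
    have "sqrt ((real (m n 1 1))\<^sup>2 / (2 * ?N n) * (2 * ?N n)) \<le> real (m n 1 1)"
      by (cases "?N n = 0") auto
    also have "m n 1 1 \<le> total_edges n"
      unfolding total_edges_def using member_le_sum[OF k, of "\<lambda>(s, t). m n s t"] by simp
    finally show "sqrt ((real (m n 1 1))\<^sup>2 / (2 * ?N n) * (2 * ?N n)) \<le> real (total_edges n)" by simp
  qed
  then show ?thesis
    by (intro tendsto_divide_0[OF tendsto_const] filterlim_at_top_imp_at_infinity)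
qed

lemma finite_S [simp]: "finite (S n)"
  using finite_subset[OF S_subgraphs] by simp

definition incl_prob :: "nat \<Rightarrow> 'v set set \<Rightarrow> real" where
  "incl_prob n \<Gamma> = measure_pmf.prob (pmf_of_set (S n)) {\<pi>. \<Gamma> \<subseteq> \<pi>}"

lemma incl_prob_eq: "incl_prob n \<Gamma> = real (card {\<pi> \<in> S n. \<Gamma> \<subseteq> \<pi>}) / real (card (S n))"
  unfolding incl_prob_def using S_nonempty by (simp add: measure_pmf_of_set Int_def)

lemma incl_prob_edge:
  "e \<in> block_edges L B n \<Longrightarrow> measure_pmf.prob (pmf_of_set (S n)) {\<pi>. e \<in> \<pi>} = edge_density n (edge_pair n e)"
  using edge_probabilities[of "fst (edge_pair n e)" "snd (edge_pair n e)" e n] edge_pair[of e n]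
  by (simp add: edge_density_def)

text \<open>A single edge is a matching, so some member of \<open>S n\<close> contains it.
  Positivity permits clearing the denominator in \<open>matching_probabilities\<close>.\<close>

lemma edge_density_pos:
  assumes "e \<in> block_edges L B n"
  shows "0 < edge_density n (edge_pair n e)"
proof -
  obtain \<pi> where \<pi>: "\<pi> \<in> S n" "{e} \<subseteq> \<pi>"
    using matchings_extend[of "{e}" n] assms by (auto simp: partial_matching_def)
  then have "0 < card {\<pi> \<in> S n. {e} \<subseteq> \<pi>}" "0 < card (S n)"
    by (auto simp: card_gt_0_iff)
  then have "0 < incl_prob n {e}"
    unfolding incl_prob_eq by simp
  then show ?thesis using incl_prob_edge[OF assms] by (simp add: incl_prob_def)
qed

text \<open>Conditions (3) and (4) with one common constant and without quotients. The bound for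
  non-matchings extends to every set of edges, because a set contained in no member of
  \<open>S n\<close> has probability 0.\<close>

lemma incl_prob_bounds:
  obtains R where "1 \<le> R"
    and "\<And>n \<Gamma>. \<Gamma> \<subseteq> block_edges L B n \<Longrightarrow> partial_matching \<Gamma> \<Longrightarrow>
        \<bar>incl_prob n \<Gamma> - (\<Prod>e\<in>\<Gamma>. edge_density n (edge_pair n e))\<bar>
        \<le> 1 / sqrt (total_edges n) * (R ^ card \<Gamma> * (\<Prod>e\<in>\<Gamma>. edge_density n (edge_pair n e)))"
    and "\<And>n \<Gamma>. \<Gamma> \<subseteq> block_edges L B n \<Longrightarrow> \<not> partial_matching \<Gamma> \<Longrightarrow>
        incl_prob n \<Gamma> \<le> R ^ card \<Gamma> * (\<Prod>e\<in>\<Gamma>. edge_density n (edge_pair n e))"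
proof -
  from matching_probabilities obtain \<rho>1 where \<rho>1: "0 < \<rho>1"
    "\<forall>n k \<Gamma>. \<Gamma> \<subseteq> block_edges L B n \<and> partial_matching \<Gamma> \<and> card \<Gamma> = k \<longrightarrow>
         \<bar>incl_prob n \<Gamma> / (\<Prod>e\<in>\<Gamma>. measure_pmf.prob (pmf_of_set (S n)) {\<pi>. e \<in> \<pi>}) - 1\<bar>
         \<le> \<rho>1 ^ k / sqrt (real (total_edges n))"
    unfolding incl_prob_def[symmetric] total_edges_def[symmetric] by (elim exE conjE)
  from nonmatching_probabilities obtain \<rho>2 where \<rho>2: "0 < \<rho>2"
    "\<forall>n k \<Gamma>. (\<exists>\<pi>\<in>S n. \<Gamma> \<subseteq> \<pi>) \<and> \<not> partial_matching \<Gamma> \<and> card \<Gamma> = k \<longrightarrow>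
         incl_prob n \<Gamma> \<le> \<rho>2 ^ k * (\<Prod>e\<in>\<Gamma>. measure_pmf.prob (pmf_of_set (S n)) {\<pi>. e \<in> \<pi>})"
    unfolding incl_prob_def[symmetric] by (elim exE conjE)
  \<comment> \<open>The 1 in the maximum supplies \<open>1 \<le> R\<close> for
    \<open>sum_Pow_squared_difference_le\<close>.\<close>
  define R where "R = max 1 (max \<rho>1 \<rho>2)"
  have R: "1 \<le> R" "\<rho>1 \<le> R" "\<rho>2 \<le> R" by (auto simp: R_def)
  have prod_eq: "(\<Prod>e\<in>\<Gamma>. measure_pmf.prob (pmf_of_set (S n)) {\<pi>. e \<in> \<pi>}) = (\<Prod>e\<in>\<Gamma>. edge_density n (edge_pair n e))"
    if "\<Gamma> \<subseteq> block_edges L B n" for n \<Gamma>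
    using that incl_prob_edge by (intro prod.cong) auto
  have prod_pos: "0 < (\<Prod>e\<in>\<Gamma>. edge_density n (edge_pair n e))" if "\<Gamma> \<subseteq> block_edges L B n" for n \<Gamma>
    using that edge_density_pos by (intro prod_pos) auto
  show thesis
  proof (rule that[OF R(1)])
    fix n \<Gamma> assume \<Gamma>: "\<Gamma> \<subseteq> block_edges L B n" "partial_matching \<Gamma>"
    let ?P = "\<Prod>e\<in>\<Gamma>. edge_density n (edge_pair n e)"
    have "\<bar>incl_prob n \<Gamma> / ?P - 1\<bar> \<le> \<rho>1 ^ card \<Gamma> / sqrt (real (total_edges n))"
      using \<rho>1(2)[rule_format, OF conjI[OF \<Gamma>(1) conjI[OF \<Gamma>(2) refl]]] unfolding prod_eq[OF \<Gamma>(1)] .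
    also have "\<dots> \<le> R ^ card \<Gamma> / sqrt (real (total_edges n))"
      using \<rho>1(1) R by (intro divide_right_mono power_mono) auto
    finally have "\<bar>incl_prob n \<Gamma> / ?P - 1\<bar> * ?P \<le> R ^ card \<Gamma> / sqrt (real (total_edges n)) * ?P"
      using prod_pos[OF \<Gamma>(1)] by (intro mult_right_mono) auto
    moreover have "\<bar>incl_prob n \<Gamma> / ?P - 1\<bar> * ?P = \<bar>(incl_prob n \<Gamma> / ?P - 1) * ?P\<bar>"
      using prod_pos[OF \<Gamma>(1)] by (simp add: abs_mult)
    moreover have "(incl_prob n \<Gamma> / ?P - 1) * ?P = incl_prob n \<Gamma> - ?P"
      using prod_pos[OF \<Gamma>(1)] by (simp add: left_diff_distrib)
    ultimately show "\<bar>incl_prob n \<Gamma> - ?P\<bar> \<le> 1 / sqrt (total_edges n) * (R ^ card \<Gamma> * ?P)" by simp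
  next
    fix n \<Gamma> assume \<Gamma>: "\<Gamma> \<subseteq> block_edges L B n" "\<not> partial_matching \<Gamma>"
    let ?P = "\<Prod>e\<in>\<Gamma>. edge_density n (edge_pair n e)"
    show "incl_prob n \<Gamma> \<le> R ^ card \<Gamma> * ?P"
    proof (cases "\<exists>\<pi>\<in>S n. \<Gamma> \<subseteq> \<pi>")
      case True
      have "incl_prob n \<Gamma> \<le> \<rho>2 ^ card \<Gamma> * ?P"
        using \<rho>2(2)[rule_format, OF conjI[OF True conjI[OF \<Gamma>(2) refl]]] unfolding prod_eq[OF \<Gamma>(1)] .
      also have "\<dots> \<le> R ^ card \<Gamma> * ?P"
        using \<rho>2(1) R prod_pos[OF \<Gamma>(1)] by (intro mult_right_mono power_mono) auto
      finally show ?thesis .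
    next
      case False
      then have "incl_prob n \<Gamma> = 0" by (auto simp: incl_prob_eq)
      then show ?thesis using R(1) prod_pos[OF \<Gamma>(1)] by simp
    qed
  qed
qed

end

section \<open>Expansion of the partition function at a fixed inverse temperature\<close>

locale fixed_temperature = block_optimization L V B lam \<nu> M \<omega> S m \<gamma>
  for L :: nat and V :: "nat \<Rightarrow> 'v set" and B lam \<nu> and M :: "nat \<Rightarrow> 'w measure" and \<omega> S m \<gamma> +
  fixes \<beta> :: real
  assumes \<beta>: "0 \<le> \<beta>"
begin

definition tilted :: "nat \<times> nat \<Rightarrow> ereal \<Rightarrow> real" where
  "tilted k = tilted_weight (\<nu> (fst k) (snd k)) \<beta>"

definition edge_var :: "nat \<times> nat \<Rightarrow> real" where
  "edge_var k = v2 (\<nu> (fst k) (snd k)) \<beta>"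

definition \<xi> :: "nat \<Rightarrow> 'v set \<Rightarrow> 'w \<Rightarrow> real" where
  "\<xi> n e x = tilted (edge_pair n e) (\<omega> n e x)"

lemma tilted_ge: "- 1 \<le> tilted k x"
  by (simp add: tilted_def tilted_weight_ge)

lemma borel_measurable_tilted [measurable]: "tilted k \<in> borel_measurable borel"
  by (simp add: tilted_def)

lemma tilted_moments:
  assumes "k \<in> block_pairs L"
  shows "(\<integral>x. tilted k x \<partial>\<nu> (fst k) (snd k)) = 0"
    and "integrable (\<nu> (fst k) (snd k)) (\<lambda>x. (tilted k x)\<^sup>2)"
    and "(\<integral>x. (tilted k x)\<^sup>2 \<partial>\<nu> (fst k) (snd k)) = edge_var k"
proof -
  have k: "(fst k, snd k) \<in> block_pairs L" using assms by simp
  note * = tilted_weight_moments[OF prob_space_law[OF k] law_not_infinity[OF k] law_exp_integrable[OF k] \<beta>]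
  show "(\<integral>x. tilted k x \<partial>\<nu> (fst k) (snd k)) = 0"
    "integrable (\<nu> (fst k) (snd k)) (\<lambda>x. (tilted k x)\<^sup>2)"
    "(\<integral>x. (tilted k x)\<^sup>2 \<partial>\<nu> (fst k) (snd k)) = edge_var k"
    unfolding tilted_def edge_var_def using * by simp_all
qed

lemma edge_var_nonneg: "k \<in> block_pairs L \<Longrightarrow> 0 \<le> edge_var k"
  using tilted_moments(3)[of k] by (metis integral_nonneg_AE AE_I2 zero_le_power2)

lemma measurable_weight: "e \<in> block_edges L B n \<Longrightarrow> \<omega> n e \<in> borel_measurable (M n)"
  using weights_indep[of n] by (auto simp: prob_space.indep_vars_def[OF prob_space_M])

lemma weight_distr:
  "e \<in> block_edges L B n \<Longrightarrow> distr (M n) borel (\<omega> n e) = \<nu> (fst (edge_pair n e)) (snd (edge_pair n e))"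
  using edge_pair[of e n] by (intro weights_law) auto

lemma measurable_\<xi>: "e \<in> block_edges L B n \<Longrightarrow> \<xi> n e \<in> borel_measurable (M n)"
  using measurable_weight[of e n] unfolding \<xi>_def by measurable

lemma \<xi>_indep: "prob_space.indep_vars (M n) (\<lambda>_. borel) (\<xi> n) (block_edges L B n)"
  using prob_space.indep_vars_compose2[OF prob_space_M weights_indep, of n "\<lambda>e. tilted (edge_pair n e)" "\<lambda>_. borel"]
  by (simp add: \<xi>_def[abs_def])

lemma \<xi>_moments:
  assumes "e \<in> block_edges L B n"
  shows "(\<integral>x. \<xi> n e x \<partial>M n) = 0"
    and "integrable (M n) (\<lambda>x. (\<xi> n e x)\<^sup>2)"
    and "(\<integral>x. (\<xi> n e x)\<^sup>2 \<partial>M n) = edge_var (edge_pair n e)"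
proof -
  let ?k = "edge_pair n e"
  note [measurable] = measurable_weight[OF assms]
  note * = tilted_moments[OF edge_pair(1)[OF assms]]
  show "(\<integral>x. \<xi> n e x \<partial>M n) = 0"
    using *(1) unfolding \<xi>_def weight_distr[OF assms, symmetric] by (subst (asm) integral_distr) auto
  show "integrable (M n) (\<lambda>x. (\<xi> n e x)\<^sup>2)"
    using *(2) unfolding \<xi>_def weight_distr[OF assms, symmetric] by (subst (asm) integrable_distr_eq) auto
  show "(\<integral>x. (\<xi> n e x)\<^sup>2 \<partial>M n) = edge_var ?k"
    using *(3) unfolding \<xi>_def weight_distr[OF assms, symmetric] by (subst (asm) integral_distr) auto
qed

text \<open>Up to a null set this is \<open>Z\<close> divided by the exponential of the centring
  sum, see \<open>partition_function_eq\<close>. It is defined by its expansion, to which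
  orthogonality applies directly.\<close>

definition normalized_partition :: "nat \<Rightarrow> 'w \<Rightarrow> real" where
  "normalized_partition n x = (\<Sum>\<Gamma>\<in>Pow (block_edges L B n). incl_prob n \<Gamma> * (\<Prod>e\<in>\<Gamma>. \<xi> n e x))"

text \<open>The independent-edge approximation to the logarithm of
  \<open>normalized_partition\<close>. All arguments of \<open>ln\<close> are positive once the
  densities are below 1, which holds for large \<open>n\<close>.\<close>

definition log_product :: "nat \<Rightarrow> 'w \<Rightarrow> real" where
  "log_product n x = (\<Sum>e\<in>block_edges L B n. ln (1 + edge_density n (edge_pair n e) * \<xi> n e x))"

lemma measurable_normalized_partition: "normalized_partition n \<in> borel_measurable (M n)"
  unfolding normalized_partition_def using measurable_\<xi>
  by (intro borel_measurable_sum borel_measurable_times borel_measurable_const borel_measurable_prod) auto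

lemma measurable_log_product: "log_product n \<in> borel_measurable (M n)"
proof -
  have "(\<lambda>x. ln (1 + edge_density n (edge_pair n e) * \<xi> n e x)) \<in> borel_measurable (M n)"
    if "e \<in> block_edges L B n" for e
    using measurable_\<xi>[OF that] by measurable
  then show ?thesis unfolding log_product_def by (intro borel_measurable_sum)
qed

text \<open>Since the edge variables are at least -1, densities below 1 keep every factor positive.
  Expanding the product yields the monomials of \<open>normalized_partition\<close>, with the
  inclusion probability replaced by the product of the edge densities.\<close>

lemma exp_log_product:
  assumes "\<And>k. k \<in> block_pairs L \<Longrightarrow> edge_density n k < 1"
  shows "exp (log_product n x) = (\<Sum>\<Gamma>\<in>Pow (block_edges L B n). (\<Prod>e\<in>\<Gamma>. edge_density n (edge_pair n e)) * (\<Prod>e\<in>\<Gamma>. \<xi> n e x))"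
proof -
  have pos: "0 < 1 + edge_density n (edge_pair n e) * \<xi> n e x" if "e \<in> block_edges L B n" for e
  proof -
    have "edge_density n (edge_pair n e) * (- 1) \<le> edge_density n (edge_pair n e) * \<xi> n e x"
      using tilted_ge by (intro mult_left_mono edge_density_nonneg) (simp add: \<xi>_def)
    then show ?thesis using assms[OF edge_pair(1)[OF that]] by simp
  qed
  then have "exp (log_product n x) = (\<Prod>e\<in>block_edges L B n. 1 + edge_density n (edge_pair n e) * \<xi> n e x)"
    unfolding log_product_def by (simp add: exp_sum)
  then show ?thesis
    by (simp add: sum_Pow_prod[symmetric] prod.distrib)
qed

text \<open>Each Boltzmann factor is \<open>exp psi * (1 + \<xi>)\<close>. After expanding over
  subsets and exchanging the sums, \<open>\<Gamma>\<close> is counted once for each subgraph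
  containing it, which produces \<open>incl_prob n \<Gamma>\<close>.\<close>

lemma partition_function_eq:
  assumes "\<And>e. e \<in> block_edges L B n \<Longrightarrow> \<omega> n e x \<noteq> -\<infinity>"
  shows "partition_function (S n) (\<lambda>e. \<omega> n e x) \<beta>
    = exp (\<Sum>(s, t)\<in>block_pairs L. real (m n s t) * psi (\<nu> s t) \<beta>) * normalized_partition n x"
proof -
  let ?E = "block_edges L B n"
  let ?psi = "\<lambda>k. psi (\<nu> (fst k) (snd k)) \<beta>"
  let ?c = "\<Sum>(s, t)\<in>block_pairs L. real (m n s t) * psi (\<nu> s t) \<beta>"
  have boltz: "boltzmann \<beta> (\<Sum>e\<in>\<pi>. \<omega> n e x) = exp ?c * (\<Sum>\<Gamma>\<in>Pow \<pi>. \<Prod>e\<in>\<Gamma>. \<xi> n e x)" if "\<pi> \<in> S n" for \<pi>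
  proof -
    have \<pi>: "\<pi> \<subseteq> ?E" using S_subgraphs that by blast
    then have fin: "finite \<pi>" by (rule finite_subset) simp
    have "boltzmann \<beta> (\<Sum>e\<in>\<pi>. \<omega> n e x) = (\<Prod>e\<in>\<pi>. boltzmann \<beta> (\<omega> n e x))"
      using assms \<pi> by (intro boltzmann_sum) auto
    also have "\<dots> = (\<Prod>e\<in>\<pi>. exp (?psi (edge_pair n e)) * (1 + \<xi> n e x))"
      by (simp add: \<xi>_def tilted_def tilted_weight_def)
    also have "\<dots> = exp (\<Sum>e\<in>\<pi>. ?psi (edge_pair n e)) * (\<Prod>e\<in>\<pi>. 1 + \<xi> n e x)"
      by (simp add: prod.distrib exp_sum[OF fin])
    \<comment> \<open>All members of \<open>S n\<close> have the same number of edges of each type,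
      so the prefactor does not depend on the subgraph.\<close>
    also have "(\<Sum>e\<in>\<pi>. ?psi (edge_pair n e)) = ?c"
      unfolding sum_edge_pair[OF \<pi>, of ?psi] using edge_counts[OF _ that]
      by (intro sum.cong refl) (auto simp: case_prod_unfold)
    also have "(\<Prod>e\<in>\<pi>. 1 + \<xi> n e x) = (\<Sum>\<Gamma>\<in>Pow \<pi>. \<Prod>e\<in>\<Gamma>. \<xi> n e x)"
      by (simp add: sum_Pow_prod[OF fin])
    finally show ?thesis .
  qed
  have Pow_sum: "(\<Sum>\<Gamma>\<in>Pow \<pi>. \<Prod>e\<in>\<Gamma>. \<xi> n e x) = (\<Sum>\<Gamma>\<in>Pow ?E. if \<Gamma> \<subseteq> \<pi> then (\<Prod>e\<in>\<Gamma>. \<xi> n e x) else 0)"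
    if "\<pi> \<in> S n" for \<pi>
  proof -
    have "\<pi> \<subseteq> ?E" using S_subgraphs that by blast
    then show ?thesis
      by (intro sum.mono_neutral_cong_left) auto
  qed
  have "(\<Sum>\<pi>\<in>S n. \<Sum>\<Gamma>\<in>Pow \<pi>. \<Prod>e\<in>\<Gamma>. \<xi> n e x)
      = (\<Sum>\<pi>\<in>S n. \<Sum>\<Gamma>\<in>Pow ?E. if \<Gamma> \<subseteq> \<pi> then (\<Prod>e\<in>\<Gamma>. \<xi> n e x) else 0)"
    using Pow_sum by (rule sum.cong[OF refl])
  also have "\<dots> = (\<Sum>\<Gamma>\<in>Pow ?E. \<Sum>\<pi>\<in>S n. if \<Gamma> \<subseteq> \<pi> then (\<Prod>e\<in>\<Gamma>. \<xi> n e x) else 0)"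
    by (rule sum.swap)
  also have "\<dots> = (\<Sum>\<Gamma>\<in>Pow ?E. real (card {\<pi> \<in> S n. \<Gamma> \<subseteq> \<pi>}) * (\<Prod>e\<in>\<Gamma>. \<xi> n e x))"
    by (simp add: sum.inter_filter[symmetric])
  finally have swap: "(\<Sum>\<pi>\<in>S n. \<Sum>\<Gamma>\<in>Pow \<pi>. \<Prod>e\<in>\<Gamma>. \<xi> n e x)
      = (\<Sum>\<Gamma>\<in>Pow ?E. real (card {\<pi> \<in> S n. \<Gamma> \<subseteq> \<pi>}) * (\<Prod>e\<in>\<Gamma>. \<xi> n e x))" .
  have "partition_function (S n) (\<lambda>e. \<omega> n e x) \<beta>
      = exp ?c * ((\<Sum>\<pi>\<in>S n. \<Sum>\<Gamma>\<in>Pow \<pi>. \<Prod>e\<in>\<Gamma>. \<xi> n e x) / real (card (S n)))"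
    unfolding partition_function_def using boltz by (simp add: sum_distrib_left)
  also have "(\<Sum>\<pi>\<in>S n. \<Sum>\<Gamma>\<in>Pow \<pi>. \<Prod>e\<in>\<Gamma>. \<xi> n e x) / real (card (S n)) = normalized_partition n x"
    unfolding swap normalized_partition_def incl_prob_eq by (simp add: sum_divide_distrib)
  finally show ?thesis .
qed

lemma AE_weights_not_minus_infinity: "AE x in M n. \<forall>e\<in>block_edges L B n. \<omega> n e x \<noteq> -\<infinity>"
proof (intro AE_finite_allI finite_block_edges)
  fix e assume e: "e \<in> block_edges L B n"
  have "AE y in distr (M n) borel (\<omega> n e). y \<noteq> -\<infinity>"
    unfolding weight_distr[OF e] using law_not_minus_infinity[of "fst (edge_pair n e)" "snd (edge_pair n e)"] edge_pair[OF e]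
    by simp
  then show "AE x in M n. \<omega> n e x \<noteq> -\<infinity>"
    using measurable_weight[OF e] by (simp add: AE_distr_iff)
qed

lemma partition_function_nonneg: "0 \<le> partition_function (S n) w \<beta>"
  unfolding partition_function_def by (intro divide_nonneg_nonneg sum_nonneg boltzmann_nonneg) auto

lemma measurable_partition_function:
  "(\<lambda>x. partition_function (S n) (\<lambda>e. \<omega> n e x) \<beta>) \<in> borel_measurable (M n)"
proof -
  have "(\<lambda>x. boltzmann \<beta> (\<Sum>e\<in>\<pi>. \<omega> n e x)) \<in> borel_measurable (M n)" if "\<pi> \<in> S n" for \<pi>
    using S_subgraphs that measurable_weight
    by (intro measurable_compose[OF _ borel_measurable_boltzmann] borel_measurable_ereal_sum) blast
  then show ?thesis
    unfolding partition_function_def by (intro borel_measurable_divide borel_measurable_sum) auto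
qed

text \<open>Removes the extended-real logarithm from the event; when the partition function is 0,
  both sides are true.\<close>

lemma log_partition_le_iff:
  "log_partition (S n) w \<beta> - ereal c \<le> ereal y \<longleftrightarrow> partition_function (S n) w \<beta> \<le> exp c * exp y"
proof (cases "partition_function (S n) w \<beta> = 0")
  case False
  then have pos: "0 < partition_function (S n) w \<beta>"
    using partition_function_nonneg[of n w] by linarith
  have "ln (partition_function (S n) w \<beta>) - c \<le> y \<longleftrightarrow> exp (ln (partition_function (S n) w \<beta>)) \<le> exp (c + y)"
    unfolding exp_le_cancel_iff by auto
  then have "ln (partition_function (S n) w \<beta>) - c \<le> y \<longleftrightarrow> partition_function (S n) w \<beta> \<le> exp (c + y)"
    using pos by simp
  then show ?thesis using False by (simp add: log_partition_def exp_add)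
qed (simp add: log_partition_def)

lemma prob_log_partition:
  "\<P>(x in M n. log_partition (S n) (\<lambda>e. \<omega> n e x) \<beta>
      - ereal (\<Sum>(s, t)\<in>block_pairs L. real (m n s t) * psi (\<nu> s t) \<beta>) \<le> ereal y)
    = \<P>(x in M n. normalized_partition n x \<le> exp y)"
proof -
  interpret prob_space "M n" by (rule prob_space_M)
  note [measurable] = measurable_partition_function measurable_normalized_partition
  show ?thesis
    unfolding log_partition_le_iff
  proof (rule finite_measure_eq_AE)
    show "AE x in M n. (x \<in> {x \<in> space (M n). partition_function (S n) (\<lambda>e. \<omega> n e x) \<beta>
        \<le> exp (\<Sum>(s, t)\<in>block_pairs L. real (m n s t) * psi (\<nu> s t) \<beta>) * exp y})
        = (x \<in> {x \<in> space (M n). normalized_partition n x \<le> exp y})"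
      using AE_weights_not_minus_infinity[of n]
      by eventually_elim (simp add: partition_function_eq)
  qed measurable
qed

end

section \<open>Convergence in distribution\<close>

context fixed_temperature
begin

text \<open>\<open>sum_Pow_squared_difference_le\<close> with
  \<open>1 / sqrt (total_edges n)\<close> for \<open>\<delta>\<close>, whose square vanishes. The
  adjacent pairs number at most \<open>2 * n^3\<close> and each contributes order
  \<open>n^-4\<close>. The exponential stays bounded, because edge number times squared density
  converges for every type.\<close>

lemma squared_coefficients_tendsto_0:
  "(\<lambda>n. \<Sum>\<Gamma>\<in>Pow (block_edges L B n).
      (incl_prob n \<Gamma> - (\<Prod>e\<in>\<Gamma>. edge_density n (edge_pair n e)))\<^sup>2 * (\<Prod>e\<in>\<Gamma>. edge_var (edge_pair n e)))
    \<longlonglongrightarrow> 0"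
proof -
  let ?E = "block_edges L B" and ?p = "\<lambda>n e. edge_density n (edge_pair n e)" and ?v = "\<lambda>n e. edge_var (edge_pair n e)"
  obtain R where R: "1 \<le> R"
    and match: "\<And>n \<Gamma>. \<Gamma> \<subseteq> ?E n \<Longrightarrow> partial_matching \<Gamma> \<Longrightarrow>
        \<bar>incl_prob n \<Gamma> - (\<Prod>e\<in>\<Gamma>. ?p n e)\<bar> \<le> 1 / sqrt (total_edges n) * (R ^ card \<Gamma> * (\<Prod>e\<in>\<Gamma>. ?p n e))"
    and nonmatch: "\<And>n \<Gamma>. \<Gamma> \<subseteq> ?E n \<Longrightarrow> \<not> partial_matching \<Gamma> \<Longrightarrow>
        incl_prob n \<Gamma> \<le> R ^ card \<Gamma> * (\<Prod>e\<in>\<Gamma>. ?p n e)"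
    by (rule incl_prob_bounds) (rule that)
  define r where "r n k = R\<^sup>2 * (edge_density n k)\<^sup>2 * edge_var k" for n k
  define q where "q n e = r n (edge_pair n e)" for n e
  \<comment> \<open>A majorant of \<open>q n e\<close> for all edges at once, with
    \<open>n^2 * Q n\<close> convergent.\<close>
  define Q where "Q n = (\<Sum>k\<in>block_pairs L. r n k)" for n
  let ?bound = "\<lambda>n. (1 / total_edges n + 2 * ((real n)\<^sup>2 * Q n)\<^sup>2 * (1 / real n)) * exp (\<Sum>e\<in>?E n. q n e)"
  have r_nonneg: "0 \<le> r n k" if "k \<in> block_pairs L" for n k
    using edge_var_nonneg[OF that] by (simp add: r_def)
  have q_bounds: "0 \<le> q n e" "q n e \<le> Q n" if "e \<in> ?E n" for n e
    using r_nonneg edge_pair(1)[OF that] member_le_sum[of "edge_pair n e" "block_pairs L" "r n"]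
    by (auto simp: q_def Q_def)
  have bound: "(\<Sum>\<Gamma>\<in>Pow (?E n). (incl_prob n \<Gamma> - (\<Prod>e\<in>\<Gamma>. ?p n e))\<^sup>2 * (\<Prod>e\<in>\<Gamma>. ?v n e)) \<le> ?bound n" for n
  proof -
    have "(\<Sum>\<Gamma>\<in>Pow (?E n). (incl_prob n \<Gamma> - (\<Prod>e\<in>\<Gamma>. ?p n e))\<^sup>2 * (\<Prod>e\<in>\<Gamma>. ?v n e))
       \<le> ((1 / sqrt (total_edges n))\<^sup>2 + (\<Sum>(e, f)\<in>adjacent_pairs n. (R\<^sup>2 * (?p n e)\<^sup>2 * ?v n e) * (R\<^sup>2 * (?p n f)\<^sup>2 * ?v n f)))
          * exp (\<Sum>e\<in>?E n. R\<^sup>2 * (?p n e)\<^sup>2 * ?v n e)"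
    proof (rule sum_Pow_squared_difference_le)
      show "\<bar>incl_prob n \<Gamma> - (\<Prod>e\<in>\<Gamma>. ?p n e)\<bar> \<le> 1 / sqrt (total_edges n) * (R ^ card \<Gamma> * (\<Prod>e\<in>\<Gamma>. ?p n e))"
        if "\<Gamma> \<subseteq> ?E n" "\<And>e f. (e, f) \<in> adjacent_pairs n \<Longrightarrow> \<not> (e \<in> \<Gamma> \<and> f \<in> \<Gamma>)" for \<Gamma>
        using that by (intro match) (auto simp: partial_matching_iff)
      show "incl_prob n \<Gamma> \<le> R ^ card \<Gamma> * (\<Prod>e\<in>\<Gamma>. ?p n e)"
        if "\<Gamma> \<subseteq> ?E n" "(e, f) \<in> adjacent_pairs n" "e \<in> \<Gamma>" "f \<in> \<Gamma>" for \<Gamma> e f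
        using that by (intro nonmatch) (auto simp: partial_matching_iff)
      show "adjacent_pairs n \<subseteq> ?E n \<times> ?E n" "\<And>e f. (e, f) \<in> adjacent_pairs n \<Longrightarrow> e \<noteq> f"
        by (auto simp: adjacent_pairs_def)
    qed (use R edge_density_nonneg edge_var_nonneg edge_pair(1) in \<open>auto simp: incl_prob_def\<close>)
    also have "\<dots> = (1 / total_edges n + (\<Sum>(e, f)\<in>adjacent_pairs n. q n e * q n f)) * exp (\<Sum>e\<in>?E n. q n e)"
      by (simp add: q_def r_def power_divide)
    also have "\<dots> \<le> ?bound n"
    proof (intro mult_right_mono add_left_mono)
      have "(\<Sum>(e, f)\<in>adjacent_pairs n. q n e * q n f) \<le> (\<Sum>(e, f)\<in>adjacent_pairs n. (Q n)\<^sup>2)"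
        using q_bounds by (intro sum_mono) (auto simp: adjacent_pairs_def power2_eq_square intro!: mult_mono order_trans[OF q_bounds])
      also have "\<dots> = real (card (adjacent_pairs n)) * (Q n)\<^sup>2" by (simp add: case_prod_unfold)
      also have "\<dots> \<le> real (2 * n ^ 3) * (Q n)\<^sup>2"
        using card_adjacent_pairs_le by (intro mult_right_mono) (auto simp del: of_nat_mult)
      \<comment> \<open>Writing \<open>n^3\<close> as \<open>n^4 / n\<close> leaves only a
        convergent factor and the vanishing \<open>1 / n\<close>; at \<open>n = 0\<close> both sides
        are 0.\<close>
      also have "\<dots> = 2 * ((real n)\<^sup>2 * Q n)\<^sup>2 * (1 / real n)"
        by (cases "n = 0") (auto simp: field_simps power2_eq_square power3_eq_cube)
      finally show "(\<Sum>(e, f)\<in>adjacent_pairs n. q n e * q n f) \<le> 2 * ((real n)\<^sup>2 * Q n)\<^sup>2 * (1 / real n)" .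
    qed simp
    finally show ?thesis .
  qed
  have sum_q: "(\<lambda>n. \<Sum>e\<in>?E n. q n e) \<longlonglongrightarrow> (\<Sum>k\<in>block_pairs L. 2 * \<gamma> (fst k) (snd k) * (R\<^sup>2 * edge_var k))"
  proof -
    have "(\<Sum>e\<in>?E n. q n e) = (\<Sum>k\<in>block_pairs L. real (card (pair_edges n k)) * (edge_density n k)\<^sup>2 * (R\<^sup>2 * edge_var k))" for n
      unfolding q_def sum_block_edges_pair by (simp add: r_def mult_ac)
    then show ?thesis
      by (simp only:) (intro tendsto_sum tendsto_mult_right card_mult_edge_density_sq_tendsto)
  qed
  define c where "c k = lim (\<lambda>n. (real n)\<^sup>2 * (edge_density n k)\<^sup>2)" for k
  have c: "(\<lambda>n. (real n)\<^sup>2 * (edge_density n k)\<^sup>2) \<longlonglongrightarrow> c k" if "k \<in> block_pairs L" for k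
    using square_mult_edge_density_sq_convergent[OF that] unfolding c_def convergent_LIMSEQ_iff .
  have Q_lim: "(\<lambda>n. (real n)\<^sup>2 * Q n) \<longlonglongrightarrow> (\<Sum>k\<in>block_pairs L. c k * (R\<^sup>2 * edge_var k))"
  proof -
    have "(real n)\<^sup>2 * Q n = (\<Sum>k\<in>block_pairs L. (real n)\<^sup>2 * (edge_density n k)\<^sup>2 * (R\<^sup>2 * edge_var k))" for n
      by (simp add: Q_def r_def sum_distrib_left mult_ac)
    then show ?thesis
      by (simp only:) (intro tendsto_sum tendsto_mult_right c)
  qed
  have "?bound \<longlonglongrightarrow> (0 + 2 * (\<Sum>k\<in>block_pairs L. c k * (R\<^sup>2 * edge_var k))\<^sup>2 * 0)
      * exp (\<Sum>k\<in>block_pairs L. 2 * \<gamma> (fst k) (snd k) * (R\<^sup>2 * edge_var k))"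
    by (intro tendsto_intros inverse_total_edges_tendsto_0 lim_1_over_n Q_lim sum_q)
  then have "?bound \<longlonglongrightarrow> 0" by simp
  then show ?thesis
  proof (rule tendsto_sandwich[OF _ _ tendsto_const, rotated 2])
    show "eventually (\<lambda>n. 0 \<le> (\<Sum>\<Gamma>\<in>Pow (?E n). (incl_prob n \<Gamma> - (\<Prod>e\<in>\<Gamma>. ?p n e))\<^sup>2 * (\<Prod>e\<in>\<Gamma>. ?v n e))) sequentially"
      by (intro always_eventually allI sum_nonneg mult_nonneg_nonneg prod_nonneg ballI edge_var_nonneg edge_pair(1)) auto
  qed (intro always_eventually allI bound)
qed

text \<open>Chebyshev's inequality: the difference is a multilinear polynomial in the edge
  variables, whose second moment is the sum shown to vanish in
  \<open>squared_coefficients_tendsto_0\<close>.\<close>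

lemma normalized_partition_close:
  assumes \<epsilon>: "0 < \<epsilon>"
  shows "(\<lambda>n. \<P>(x in M n. \<bar>normalized_partition n x - exp (log_product n x)\<bar> \<ge> \<epsilon>)) \<longlonglongrightarrow> 0"
proof -
  let ?c = "\<lambda>n \<Gamma>. incl_prob n \<Gamma> - (\<Prod>e\<in>\<Gamma>. edge_density n (edge_pair n e))"
  let ?s = "\<lambda>n. \<Sum>\<Gamma>\<in>Pow (block_edges L B n). (?c n \<Gamma>)\<^sup>2 * (\<Prod>e\<in>\<Gamma>. edge_var (edge_pair n e))"
  have "eventually (\<lambda>n. \<forall>k\<in>block_pairs L. edge_density n k < 1) sequentially"
    by (intro eventually_ball_finite finite_block_pairs ballI order_tendstoD(2)[OF edge_density_tendsto_0]) auto
  then have "eventually (\<lambda>n. norm (\<P>(x in M n. \<bar>normalized_partition n x - exp (log_product n x)\<bar> \<ge> \<epsilon>)) \<le> ?s n / \<epsilon>\<^sup>2) sequentially"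
  proof eventually_elim
    case (elim n)
    interpret prob_space "M n" by (rule prob_space_M)
    have diff: "normalized_partition n x - exp (log_product n x)
        = (\<Sum>\<Gamma>\<in>Pow (block_edges L B n). ?c n \<Gamma> * (\<Prod>e\<in>\<Gamma>. \<xi> n e x))" for x
      using elim unfolding normalized_partition_def
      by (subst exp_log_product) (auto simp: sum_subtractf left_diff_distrib)
    note moment = multilinear_second_moment[OF \<xi>_indep finite_block_edges \<xi>_moments(2,1,3), where c = "?c n", folded diff]
    have "prob {x \<in> space (M n). \<bar>normalized_partition n x - exp (log_product n x)\<bar> \<ge> \<epsilon>}
       \<le> expectation (\<lambda>x. (normalized_partition n x - exp (log_product n x))\<^sup>2) / \<epsilon>\<^sup>2"
      using measurable_normalized_partition[of n] measurable_log_product[of n] moment(1)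
      by (intro second_moment_method \<epsilon>) auto
    then show ?case using moment(2) by simp
  qed
  moreover have "(\<lambda>n. ?s n / \<epsilon>\<^sup>2) \<longlonglongrightarrow> 0"
    using tendsto_divide[OF squared_coefficients_tendsto_0 tendsto_const[of "\<epsilon>\<^sup>2"]] \<epsilon> by simp
  ultimately show ?thesis by (rule Lim_null_comparison)
qed

text \<open>Half the variance of the limit law, and the negative of its mean.\<close>

definition limit_variance :: real where
  "limit_variance = (\<Sum>(s, t)\<in>block_pairs L. \<gamma> s t * v2 (\<nu> s t) \<beta>)"

lemma limit_variance_nonneg: "0 \<le> limit_variance"
  unfolding limit_variance_def
proof (rule sum_nonneg, clarify)
  fix s t assume k: "(s, t) \<in> block_pairs L"
  show "0 \<le> \<gamma> s t * v2 (\<nu> s t) \<beta>"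
    using gamma_pos[OF k] edge_var_nonneg[OF k] by (simp add: edge_var_def)
qed

text \<open>Levy's continuity theorem. Independence factors the characteristic function over the
  edges; grouping by type, \<open>log_affine_char_tendsto\<close> gives the limit of the sum of the
  deviations from 1, and \<open>prod_one_plus_tendsto_exp\<close> exponentiates it.\<close>

lemma log_product_weak_conv:
  "weak_conv_m (\<lambda>n. distr (M n) borel (log_product n)) (normal_law (- limit_variance) (2 * limit_variance))"
proof (rule levy_continuity)
  show "real_distribution (distr (M n) borel (log_product n))" for n
    by (intro prob_space.real_distribution_distr prob_space_M measurable_log_product)
  show "real_distribution (normal_law (- limit_variance) (2 * limit_variance))"
    using limit_variance_nonneg by (intro real_distribution_normal_law) simp
  fix t :: real
  \<comment> \<open>The characteristic function of one summand at \<open>t\<close>, written through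
    the law of the weight so that all edges of type \<open>k\<close> share it.\<close>
  define \<phi> where "\<phi> n k = (CLINT x|\<nu> (fst k) (snd k). iexp (t * ln (1 + edge_density n k * tilted k x)))" for n k
  let ?E = "block_edges L B"
  have char_edge: "char (distr (M n) borel (\<lambda>x. ln (1 + edge_density n (edge_pair n e) * \<xi> n e x))) t = \<phi> n (edge_pair n e)"
    if e: "e \<in> ?E n" for n e
  proof -
    note [measurable] = measurable_weight[OF e] borel_measurable_tilted measurable_\<xi>[OF e]
    show ?thesis
      unfolding char_def \<phi>_def weight_distr[OF e, symmetric]
      by (subst (1 2) integral_distr) (simp_all add: \<xi>_def)
  qed
  have char_eq: "char (distr (M n) borel (log_product n)) t = (\<Prod>e\<in>?E n. 1 + (\<phi> n (edge_pair n e) - 1))" for n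
  proof -
    interpret prob_space "M n" by (rule prob_space_M)
    have "indep_vars (\<lambda>_. borel) (\<lambda>e x. ln (1 + edge_density n (edge_pair n e) * \<xi> n e x)) (?E n)"
      by (rule indep_vars_compose2[OF \<xi>_indep]) simp
    from char_distr_sum[OF this, of t] show ?thesis
      unfolding log_product_def[abs_def] using char_edge by simp
  qed
  have norm_\<phi>: "norm (\<phi> n (edge_pair n e)) \<le> 1" if e: "e \<in> ?E n" for n e
  proof -
    note [measurable] = measurable_\<xi>[OF e]
    interpret real_distribution "distr (M n) borel (\<lambda>x. ln (1 + edge_density n (edge_pair n e) * \<xi> n e x))"
      by (intro prob_space.real_distribution_distr prob_space_M) measurable
    show ?thesis unfolding char_edge[OF e, symmetric] by (rule cmod_char_le_1)
  qed
  let ?N = "\<lambda>n k. of_nat (card (pair_edges n k))"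
  have lim_\<phi>: "(\<lambda>n. ?N n k * (\<phi> n k - 1)) \<longlonglongrightarrow> of_real (2 * \<gamma> (fst k) (snd k) * edge_var k) * log_remainder t 0"
    if k: "k \<in> block_pairs L" for k
  proof -
    have "(fst k, snd k) \<in> block_pairs L" using k by simp
    note law = prob_space_law[OF this] sets_law[OF this]
    have "tilted k \<in> borel_measurable (\<nu> (fst k) (snd k))"
      using borel_measurable_tilted[of k] by (simp add: measurable_cong_sets[OF law(2) refl])
    from log_affine_char_tendsto[OF law(1) this tilted_ge tilted_moments(2,1)[OF k] edge_density_nonneg
        edge_density_tendsto_0[OF k] card_mult_edge_density_sq_tendsto[OF k], of t]
    show ?thesis unfolding \<phi>_def tilted_moments(3)[OF k] by simp
  qed
  have "(\<lambda>n. \<Prod>e\<in>?E n. 1 + (\<phi> n (edge_pair n e) - 1))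
      \<longlonglongrightarrow> exp (\<Sum>k\<in>block_pairs L. of_real (2 * \<gamma> (fst k) (snd k) * edge_var k) * log_remainder t 0)"
  proof (rule prod_one_plus_tendsto_exp[OF finite_block_edges])
    show "norm (1 + (\<phi> n (edge_pair n e) - 1)) \<le> 1" if "e \<in> ?E n" for n e
      using norm_\<phi>[OF that] by simp
    show "(\<lambda>n. \<Sum>e\<in>?E n. \<phi> n (edge_pair n e) - 1)
        \<longlonglongrightarrow> (\<Sum>k\<in>block_pairs L. of_real (2 * \<gamma> (fst k) (snd k) * edge_var k) * log_remainder t 0)"
      unfolding sum_block_edges_pair[where f = "\<lambda>k. \<phi> _ k - 1"] by (intro tendsto_sum lim_\<phi>)
    have sq: "(\<lambda>n. ?N n k * (norm (\<phi> n k - 1))\<^sup>2) \<longlonglongrightarrow> 0" if k: "k \<in> block_pairs L" for k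
    proof -
      \<comment> \<open>With \<open>N\<close> edges, \<open>N * \<bar>\<phi> - 1\<bar>^2\<close> is
        \<open>\<bar>N * (\<phi> - 1)\<bar>^2 / N\<close>: a convergent numerator over a diverging
        denominator.\<close>
      have "(\<lambda>n. (norm (?N n k * (\<phi> n k - 1)))\<^sup>2 / ?N n k) \<longlonglongrightarrow> 0"
        by (rule tendsto_divide_0[OF tendsto_power[OF tendsto_norm[OF lim_\<phi>[OF k]]]
            filterlim_at_top_imp_at_infinity[OF card_pair_edges_at_top[OF k]]])
      moreover have "(norm (?N n k * (\<phi> n k - 1)))\<^sup>2 / ?N n k = ?N n k * (norm (\<phi> n k - 1))\<^sup>2" for n
        by (cases "card (pair_edges n k) = 0") (auto simp: norm_mult power2_eq_square)
      ultimately show ?thesis by simp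
    qed
    show "(\<lambda>n. \<Sum>e\<in>?E n. (norm (\<phi> n (edge_pair n e) - 1))\<^sup>2) \<longlonglongrightarrow> 0"
      unfolding sum_block_edges_pair[where f = "\<lambda>k. (norm (\<phi> _ k - 1))\<^sup>2"] using tendsto_sum[of "block_pairs L", OF sq] by simp
  qed
  moreover have "exp (\<Sum>k\<in>block_pairs L. of_real (2 * \<gamma> (fst k) (snd k) * edge_var k) * log_remainder t 0)
      = char (normal_law (- limit_variance) (2 * limit_variance)) t"
  proof -
    have "(\<Sum>k\<in>block_pairs L. 2 * \<gamma> (fst k) (snd k) * edge_var k) = 2 * limit_variance"
      by (simp add: limit_variance_def case_prod_unfold edge_var_def sum_distrib_left mult.assoc)
    then have "(\<Sum>k\<in>block_pairs L. of_real (2 * \<gamma> (fst k) (snd k) * edge_var k) * log_remainder t 0)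
        = of_real (2 * limit_variance) * log_remainder t 0"
      unfolding sum_distrib_right[symmetric] of_real_sum[symmetric] by simp
    \<comment> \<open>The value \<open>- (t^2 + \<i> * t) / 2\<close> of the remainder at 0 ties the
      mean to the variance: \<open>- \<i> * t / 2\<close> yields the shift and
      \<open>- t^2 / 2\<close> the Gaussian factor.\<close>
    also have "\<dots> = \<i> * of_real (t * - limit_variance) - of_real (2 * limit_variance * t\<^sup>2 / 2)"
      by (simp add: log_remainder_def field_simps)
    finally show ?thesis using limit_variance_nonneg by (simp only: char_normal_law)
  qed
  ultimately show "(\<lambda>n. char (distr (M n) borel (log_product n)) t)
      \<longlonglongrightarrow> char (normal_law (- limit_variance) (2 * limit_variance)) t"
    by (simp only: char_eq)
qed

text \<open>By \<open>prob_log_partition\<close> the distribution function is that of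
  \<open>normalized_partition\<close> at \<open>exp y\<close>, so \<open>prob_le_exp_tendsto\<close>
  applies with \<open>log_product\<close> as the variable on the logarithmic scale.\<close>

lemma log_partition_converges:
  "converges_in_distribution M
    (\<lambda>n x. log_partition (S n) (\<lambda>e. \<omega> n e x) \<beta>
      - ereal (\<Sum>(s, t)\<in>block_pairs L. real (m n s t) * psi (\<nu> s t) \<beta>))
    (normal_law (- limit_variance) (2 * limit_variance))"
  unfolding converges_in_distribution_def weak_conv_def prob_log_partition
  using limit_variance_nonneg
  by (intro allI impI prob_le_exp_tendsto[where Y = "log_product"] prob_space_M measurable_log_product
      measurable_normalized_partition real_distribution_normal_law log_product_weak_conv
      normalized_partition_close) auto

end

theorem theorem3p1:
  fixes L :: nat
    and V :: "nat \<Rightarrow> 'v set"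
    and B :: "nat \<Rightarrow> nat \<Rightarrow> 'v set"
    and lam :: "nat \<Rightarrow> real"
    and \<nu> :: "nat \<Rightarrow> nat \<Rightarrow> ereal measure"
    and M :: "nat \<Rightarrow> 'w measure"
    and \<omega> :: "nat \<Rightarrow> 'v set \<Rightarrow> 'w \<Rightarrow> ereal"
    and S :: "nat \<Rightarrow> 'v set set set"
    and m :: "nat \<Rightarrow> nat \<Rightarrow> nat \<Rightarrow> nat"
    and \<gamma> :: "nat \<Rightarrow> nat \<Rightarrow> real"
    and \<beta> :: real
  assumes "block_optimization L V B lam \<nu> M \<omega> S m \<gamma>"
    and "0 \<le> \<beta>"
  shows "converges_in_distribution M
    (\<lambda>n x. log_partition (S n) (\<lambda>e. \<omega> n e x) \<beta>
      - ereal (\<Sum>(s, t)\<in>block_pairs L. real (m n s t) * psi (\<nu> s t) \<beta>))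
    (normal_law (- (\<Sum>(s, t)\<in>block_pairs L. \<gamma> s t * v2 (\<nu> s t) \<beta>))
                (2 * (\<Sum>(s, t)\<in>block_pairs L. \<gamma> s t * v2 (\<nu> s t) \<beta>)))"
proof -
  interpret fixed_temperature L V B lam \<nu> M \<omega> S m \<gamma> \<beta>
    using assms by (simp add: fixed_temperature_def fixed_temperature_axioms_def)
  show ?thesis
    using log_partition_converges unfolding limit_variance_def .
qed

end
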